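(* Let $D$ be a weighted oriented path with $V(D)=\{x_1,x_2,\ldots,x_n,y_1,y_2,\ldots,y_m\}$, the vertices being listed in the order in which they occur along the underlying path. Let $D'$ be the induced weighted oriented path of $D$ with $V(D')=\{x_1,x_2,\ldots,x_n\}$, and assume $N_D^-(x_{n-1})\cap V^+(D)=\emptyset$. If $I(D')^{(s)}\neq I(D')^s$ for some $s\geq 2$, then $I(D)^{(s)}\neq I(D)^s$ (for the same $s$).
   Context: A weighted oriented graph $D=(V(D),E(D),w)$ has a finite simple underlying graph, each edge $\{x,y\}$ given exactly one orientation, $(x,y)\in E(D)$ meaning $x\to y$, and a weight function $w:V(D)\to\mathbb N=\{1,2,\ldots\}$. Convention: every source vertex (a vertex with no incoming edge) has weight $1$. A weighted oriented path is a weighted oriented graph whose underlying graph is a path (edges may be oriented arbitrarily). Let $k$ be a field; vertices are identified with variables of a polynomial ring $R$ over $k$. The edge ideal is $I(D)=(xy^{w(y)}\mid (x,y)\in E(D))\subseteq R$. For a homogeneous ideal $I\subseteq R$ and $s\geq 1$, the $s$-th symbolic power is $I^{(s)}=\bigcap_{P\in\operatorname{Ass} I}(I^sR_P\cap R)$, over all associated primes of $I$. For $T\subset V(D)$ the induced digraph of $D$ on $T$ is the weighted oriented graph with vertex set $T$, whose edges are the $(u,v)\in E(D)$ with $u,v\in T$, and where the weight of $u\in T$ equals its weight in $D$ if $u$ is not a source in the induced digraph, and equals $1$ otherwise. $N_D^-(x)=\{y\mid (y,x)\in E(D)\}$ and $V^+(D)=\{x\in V(D)\mid w(x)\neq 1\}$.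 *)

theory Defs
  imports "HOL-Library.Poly_Mapping" "HOL-Algebra.Ideal_Product"
begin

section \<open>Weighted oriented graphs\<close>

record 'v wo_graph =
  verts :: "'v set"
  edges :: "('v \<times> 'v) set"
  weight :: "'v \<Rightarrow> nat"

definition in_nbrs :: "'v wo_graph \<Rightarrow> 'v \<Rightarrow> 'v set" where
  "in_nbrs D x = {y. (y, x) \<in> edges D}"

definition is_source :: "'v wo_graph \<Rightarrow> 'v \<Rightarrow> bool" where
  "is_source D x \<longleftrightarrow> x \<in> verts D \<and> in_nbrs D x = {}"

definition vplus :: "'v wo_graph \<Rightarrow> 'v set" where
  "vplus D = {x \<in> verts D. weight D x \<noteq> 1}"

text \<open>Condition \<open>oriented\<close> excludes loops as well (take \<open>x = y\<close>), so the underlying graph is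
  simple and each of its edges carries exactly one orientation. Weights outside
  \<^term>\<open>verts D\<close> are irrelevant.\<close>

locale weighted_oriented_graph =
  fixes D :: "'v wo_graph"
  assumes finite_verts: "finite (verts D)"
    and edges_in_verts: "edges D \<subseteq> verts D \<times> verts D"
    and oriented: "(x, y) \<in> edges D \<Longrightarrow> (y, x) \<notin> edges D"
    and weight_pos: "x \<in> verts D \<Longrightarrow> weight D x \<ge> 1"
    and weight_source: "is_source D x \<Longrightarrow> weight D x = 1"

text \<open>The underlying graph is a path, and \<open>vs\<close> lists all the vertices in the order in which they
  occur along it.\<close>

locale weighted_oriented_path = weighted_oriented_graph D
  for D :: "'v wo_graph" +
  fixes vs :: "'v list"
  assumes distinct_vs: "distinct vs"
    and set_vs: "set vs = verts D"
    and adjacent_iff: "(u, v) \<in> edges D \<or> (v, u) \<in> edges D \<longleftrightarrow>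
      (\<exists>i. Suc i < length vs \<and> {u, v} = {vs ! i, vs ! Suc i})"

definition induced_wo_graph :: "'v wo_graph \<Rightarrow> 'v set \<Rightarrow> 'v wo_graph" where
  "induced_wo_graph D T =
     (let E = {(u, v) \<in> edges D. u \<in> T \<and> v \<in> T}
      in \<lparr>verts = T, edges = E,
          weight = (\<lambda>u. if \<exists>v. (v, u) \<in> E then weight D u else 1)\<rparr>)"


section \<open>The polynomial ring on the vertices and edge ideals\<close>

text \<open>Monomials are finitely supported exponent functions.\<close>

type_synonym ('v, 'k) mpoly = "('v \<Rightarrow>\<^sub>0 nat) \<Rightarrow>\<^sub>0 'k"

definition pvar :: "'v \<Rightarrow> ('v, 'k::comm_ring_1) mpoly" where
  "pvar x = Poly_Mapping.single (Poly_Mapping.single x 1) 1"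

text \<open>\<open>poly_ring V\<close> is \<open>k[V]\<close>: the polynomials all of whose monomials only involve variables in
  \<open>V\<close>.\<close>

definition poly_ring :: "'v set \<Rightarrow> ('v, 'k::comm_ring_1) mpoly ring" where
  "poly_ring V = \<lparr>carrier = {p. \<forall>m \<in> Poly_Mapping.keys p. Poly_Mapping.keys m \<subseteq> V},
     mult = (*), one = 1, zero = 0, add = (+)\<rparr>"

abbreviation graph_ring :: "'v wo_graph \<Rightarrow> ('v, 'k::field) mpoly ring" where
  "graph_ring D \<equiv> poly_ring (verts D)"

definition edge_ideal :: "'v wo_graph \<Rightarrow> ('v, 'k::field) mpoly set" where
  "edge_ideal D = Idl\<^bsub>graph_ring D\<^esub> {pvar x * pvar y ^ weight D y | x y. (x, y) \<in> edges D}"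


section \<open>Localization\<close>

text \<open>The localization of \<open>R\<close> at a multiplicative set \<open>S\<close>: \<open>a/u = b/v\<close> iff
  \<open>t(av - bu) = 0\<close> for some \<open>t \<in> S\<close>. As for the quotient rings of the library, the operations
  on classes are unions over all choices of representatives.\<close>

definition loc_rel :: "('a, 'b) ring_scheme \<Rightarrow> 'a set \<Rightarrow> (('a \<times> 'a) \<times> ('a \<times> 'a)) set" where
  "loc_rel R S = {((a, u), (b, v)). a \<in> carrier R \<and> u \<in> S \<and> b \<in> carrier R \<and> v \<in> S \<and>
     (\<exists>t\<in>S. t \<otimes>\<^bsub>R\<^esub> ((a \<otimes>\<^bsub>R\<^esub> v) \<ominus>\<^bsub>R\<^esub> (b \<otimes>\<^bsub>R\<^esub> u)) = \<zero>\<^bsub>R\<^esub>)}"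

definition loc_frac :: "('a, 'b) ring_scheme \<Rightarrow> 'a set \<Rightarrow> 'a \<Rightarrow> 'a \<Rightarrow> ('a \<times> 'a) set" where
  "loc_frac R S a u = loc_rel R S `` {(a, u)}"

definition localization :: "('a, 'b) ring_scheme \<Rightarrow> 'a set \<Rightarrow> ('a \<times> 'a) set ring" where
  "localization R S =
     \<lparr>carrier = {loc_frac R S a u | a u. a \<in> carrier R \<and> u \<in> S},
      mult = (\<lambda>X Y. \<Union>(a, u)\<in>X. \<Union>(b, v)\<in>Y. loc_frac R S (a \<otimes>\<^bsub>R\<^esub> b) (u \<otimes>\<^bsub>R\<^esub> v)),
      one = loc_frac R S \<one>\<^bsub>R\<^esub> \<one>\<^bsub>R\<^esub>,
      zero = loc_frac R S \<zero>\<^bsub>R\<^esub> \<one>\<^bsub>R\<^esub>,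
      add = (\<lambda>X Y. \<Union>(a, u)\<in>X. \<Union>(b, v)\<in>Y.
        loc_frac R S ((a \<otimes>\<^bsub>R\<^esub> v) \<oplus>\<^bsub>R\<^esub> (b \<otimes>\<^bsub>R\<^esub> u)) (u \<otimes>\<^bsub>R\<^esub> v))\<rparr>"

text \<open>\<open>J R\<^sub>P \<inter> R\<close>: the preimage, under the canonical map \<open>f \<mapsto> f/1\<close>, of the ideal of \<open>R\<^sub>P\<close>
  generated by the image of \<open>J\<close>.\<close>

definition local_contraction :: "('a, 'b) ring_scheme \<Rightarrow> 'a set \<Rightarrow> 'a set \<Rightarrow> 'a set" where
  "local_contraction R P J =
     (let S = carrier R - P; \<phi> = (\<lambda>f. loc_frac R S f \<one>\<^bsub>R\<^esub>)
      in {f \<in> carrier R. \<phi> f \<in> Idl\<^bsub>localization R S\<^esub> (\<phi> ` J)})"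


section \<open>Ordinary and symbolic powers\<close>

definition associated_primes :: "('a, 'b) ring_scheme \<Rightarrow> 'a set \<Rightarrow> 'a set set" where
  "associated_primes R I =
     {P. primeideal P R \<and> (\<exists>f\<in>carrier R. P = {g \<in> carrier R. g \<otimes>\<^bsub>R\<^esub> f \<in> I})}"

abbreviation ideal_power :: "('a, 'b) ring_scheme \<Rightarrow> 'a set \<Rightarrow> nat \<Rightarrow> 'a set" where
  "ideal_power R I s \<equiv> I [^]\<^bsub>ideals_set R\<^esub> s"

text \<open>Written as a subset of the carrier, rather than as a bare intersection, only because of the
  improper ideal, which has no associated primes.\<close>

definition symbolic_power :: "('a, 'b) ring_scheme \<Rightarrow> 'a set \<Rightarrow> nat \<Rightarrow> 'a set" where
  "symbolic_power R I s =
     {f \<in> carrier R. \<forall>P \<in> associated_primes R I. f \<in> local_contraction R P (ideal_power R I s)}"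

end

theory Submission
  imports Defs
begin

text \<open>All ideals involved are generated by monomials, so the argument takes place among exponents. The
  edge monomials of \<open>D'\<close> are those of \<open>D\<close> whose variables lie in \<open>X = {x\<^sub>1, \<dots>, x\<^sub>n}\<close>; hence a monomial in
  these variables lies in \<open>I(D)\<^sup>s\<close> only if it lies in \<open>I(D')\<^sup>s\<close>. Membership in a symbolic power is
  decided monomial by monomial (\<open>symbolic_power_monomialwise\<close>, \<open>monomial_in_symbolic_power\<close>): \<open>u\<close>
  belongs to it if and only if, for each associated prime \<open>P\<close>, some monomial in variables outside \<open>P\<close>
  multiplies \<open>u\<close> into the ordinary power. So take a monomial \<open>u\<close> that lies in the symbolic but not in the
  ordinary power of \<open>I(D')\<close>. It is not in \<open>I(D)\<^sup>s\<close>, and it remains to find multipliers for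
  the associated primes of \<open>I(D)\<close>.

  Let \<open>P\<close> be such a prime, \<open>C\<close> its set of variables, and \<open>g \<notin> I(D)\<close> a monomial with \<open>vg \<in> I(D)\<close> for all
  \<open>v \<in> C\<close>. The part \<open>h\<close> of \<open>g\<close> in the variables \<open>X\<close> is not in \<open>I(D')\<close>, and it yields an associated prime
  of \<open>I(D')\<close>, generated by a set of variables \<open>C'\<close>, that contains every variable a power of which multiplies
  \<open>h\<close> into \<open>I(D')\<close> (\<open>exists_associated_prime\<close>). Write \<open>a = x\<^sub>n\<^sub>-\<^sub>1\<close> and \<open>b = x\<^sub>n\<close>. All edges at a
  vertex of \<open>X\<close> other than \<open>b\<close> are edges of \<open>D'\<close>, so \<open>C \<inter> X \<subseteq> C' \<union> {b}\<close>. The multiplier of \<open>u\<close> for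
  \<open>C'\<close> therefore serves for \<open>P\<close> too, unless \<open>b\<close> is in \<open>C\<close> but not in \<open>C'\<close>, when the multiplier may contain
  the forbidden variable \<open>b\<close>.

  In that case the condition on the in-neighbours of \<open>a\<close> provides another edge of \<open>D'\<close> at \<open>a\<close>, with an
  endpoint \<open>z \<notin> C\<close>, whose monomial divides that of the edge between \<open>a\<close> and \<open>b\<close> times a power of \<open>z\<close>
  (\<open>leaf_edge_redirect\<close>). Replacing the latter edge by the former in a product of \<open>s\<close> edges removes \<open>b\<close>,
  and the power of \<open>b\<close> in the multiplier can be exchanged for a power of \<open>z\<close>. This part is carried out for an
  induced subgraph of any weighted oriented graph that is attached to the rest at a leaf \<open>b\<close>.\<close>

section \<open>Localization and contraction\<close>

locale multiplicative_subset = cring R for R (structure) +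
  fixes S :: "'a set"
  assumes S_carrier: "S \<subseteq> carrier R"
    and S_one [simp, intro]: "\<one> \<in> S"
    and S_mult [simp, intro]: "u \<in> S \<Longrightarrow> v \<in> S \<Longrightarrow> u \<otimes> v \<in> S"
begin

lemma S_closed [simp]: "u \<in> S \<Longrightarrow> u \<in> carrier R"
  using S_carrier by blast

text \<open>Clearing the subtraction from the definition turns every later argument about representatives
  into a rearrangement of products.\<close>

lemma loc_rel_iff:
  "((a, u), (b, v)) \<in> loc_rel R S \<longleftrightarrow>
     a \<in> carrier R \<and> u \<in> S \<and> b \<in> carrier R \<and> v \<in> S \<and>
     (\<exists>t\<in>S. t \<otimes> (a \<otimes> v) = t \<otimes> (b \<otimes> u))"
proof -
  have "t \<otimes> (a \<otimes> v \<ominus> b \<otimes> u) = \<zero> \<longleftrightarrow> t \<otimes> (a \<otimes> v) = t \<otimes> (b \<otimes> u)"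
    if "a \<in> carrier R" "u \<in> S" "b \<in> carrier R" "v \<in> S" "t \<in> S" for t
  proof -
    have "t \<otimes> (a \<otimes> v \<ominus> b \<otimes> u) = t \<otimes> (a \<otimes> v) \<ominus> t \<otimes> (b \<otimes> u)"
      using that by (simp add: r_distr r_minus a_minus_def)
    moreover have "x \<ominus> y = \<zero> \<longleftrightarrow> x = y" if "x \<in> carrier R" "y \<in> carrier R" for x y
      using that by (metis a_inv_closed a_minus_def minus_equality minus_minus r_neg)
    ultimately show ?thesis using that by simp
  qed
  then show ?thesis unfolding loc_rel_def by blast
qed

lemma equiv_loc_rel: "equiv (carrier R \<times> S) (loc_rel R S)"
proof (rule equivI)
  show "loc_rel R S \<subseteq> (carrier R \<times> S) \<times> (carrier R \<times> S)"
    unfolding loc_rel_def by blast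
  show "refl_on (carrier R \<times> S) (loc_rel R S)"
    by (rule refl_onI) (auto simp: loc_rel_iff)
  show "sym (loc_rel R S)"
    by (rule symI) (metis loc_rel_iff surj_pair)
  show "trans (loc_rel R S)"
  proof (rule transI)
    fix X Y Z
    assume "(X, Y) \<in> loc_rel R S" "(Y, Z) \<in> loc_rel R S"
    moreover obtain a u b v c w where [simp]: "X = (a, u)" "Y = (b, v)" "Z = (c, w)"
      by (metis surj_pair)
    ultimately obtain t s where car: "a \<in> carrier R" "u \<in> S" "b \<in> carrier R" "v \<in> S"
      "c \<in> carrier R" "w \<in> S" "t \<in> S" "s \<in> S"
      and t: "t \<otimes> (a \<otimes> v) = t \<otimes> (b \<otimes> u)" and s: "s \<otimes> (b \<otimes> w) = s \<otimes> (c \<otimes> v)"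
      by (auto simp: loc_rel_iff)
    \<comment> \<open>zero divisors are allowed, so the middle denominator \<open>v\<close> has to be kept in the witness\<close>
    have "(t \<otimes> s \<otimes> v) \<otimes> (a \<otimes> w) = (s \<otimes> w) \<otimes> (t \<otimes> (a \<otimes> v))"
      using car by (simp add: m_ac)
    also have "\<dots> = (t \<otimes> u) \<otimes> (s \<otimes> (b \<otimes> w))"
      using car by (simp add: t) (simp add: m_ac)
    also have "\<dots> = (t \<otimes> s \<otimes> v) \<otimes> (c \<otimes> u)"
      using car by (simp add: s) (simp add: m_ac)
    finally have "\<exists>r\<in>S. r \<otimes> (a \<otimes> w) = r \<otimes> (c \<otimes> u)"
      using car by blast
    then show "(X, Z) \<in> loc_rel R S"
      using car by (simp add: loc_rel_iff)
  qed
qed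

lemma loc_frac_eq_iff:
  assumes "a \<in> carrier R" "u \<in> S" "b \<in> carrier R" "v \<in> S"
  shows "loc_frac R S a u = loc_frac R S b v \<longleftrightarrow>
    (\<exists>t\<in>S. t \<otimes> (a \<otimes> v) = t \<otimes> (b \<otimes> u))"
  unfolding loc_frac_def using assms eq_equiv_class_iff[OF equiv_loc_rel, of "(a, u)" "(b, v)"]
  by (simp add: loc_rel_iff)

lemma loc_frac_eqI:
  assumes "a \<in> carrier R" "u \<in> S" "b \<in> carrier R" "v \<in> S" "a \<otimes> v = b \<otimes> u"
  shows "loc_frac R S a u = loc_frac R S b v"
  using assms by (subst loc_frac_eq_iff) auto

lemma mem_loc_frac_iff:
  assumes "a \<in> carrier R" "u \<in> S"
  shows "(b, v) \<in> loc_frac R S a u \<longleftrightarrow>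
    b \<in> carrier R \<and> v \<in> S \<and> loc_frac R S b v = loc_frac R S a u"
proof -
  have "(b, v) \<in> loc_frac R S a u \<longleftrightarrow> ((a, u), (b, v)) \<in> loc_rel R S"
    by (simp add: loc_frac_def)
  also have "\<dots> \<longleftrightarrow> b \<in> carrier R \<and> v \<in> S \<and> loc_frac R S a u = loc_frac R S b v"
    using assms by (subst loc_rel_iff) (metis loc_frac_eq_iff)
  finally show ?thesis by metis
qed

lemma mem_loc_frac_self:
  "a \<in> carrier R \<Longrightarrow> u \<in> S \<Longrightarrow> (a, u) \<in> loc_frac R S a u"
  by (simp add: mem_loc_frac_iff)

text \<open>The operations of the localization are unions over all representatives; such a union
  is a single class because each of its members is the same class.\<close>

lemma Union_representatives:
  assumes "a \<in> carrier R" "u \<in> S" "b \<in> carrier R" "v \<in> S"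
    and "\<And>a' u' b' v'. (a', u') \<in> loc_frac R S a u \<Longrightarrow> (b', v') \<in> loc_frac R S b v \<Longrightarrow>
           F a' u' b' v' = F a u b v"
  shows "(\<Union>(a', u') \<in> loc_frac R S a u. \<Union>(b', v') \<in> loc_frac R S b v. F a' u' b' v') = F a u b v"
  using assms(5) mem_loc_frac_self[OF assms(1,2)] mem_loc_frac_self[OF assms(3,4)] by blast

lemma loc_mult:
  assumes car: "a \<in> carrier R" "u \<in> S" "b \<in> carrier R" "v \<in> S"
  shows "loc_frac R S a u \<otimes>\<^bsub>localization R S\<^esub> loc_frac R S b v = loc_frac R S (a \<otimes> b) (u \<otimes> v)"
  unfolding localization_def monoid.simps
proof (rule Union_representatives[OF car, where F = "\<lambda>a u b v. loc_frac R S (a \<otimes> b) (u \<otimes> v)"])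
  fix a' u' b' v'
  assume "(a', u') \<in> loc_frac R S a u" "(b', v') \<in> loc_frac R S b v"
  then obtain t s where c: "a' \<in> carrier R" "u' \<in> S" "b' \<in> carrier R" "v' \<in> S" "t \<in> S" "s \<in> S"
    and t: "t \<otimes> (a' \<otimes> u) = t \<otimes> (a \<otimes> u')" and s: "s \<otimes> (b' \<otimes> v) = s \<otimes> (b \<otimes> v')"
    using car by (auto simp: mem_loc_frac_iff loc_frac_eq_iff)
  have "(t \<otimes> s) \<otimes> ((a' \<otimes> b') \<otimes> (u \<otimes> v)) = (t \<otimes> (a' \<otimes> u)) \<otimes> (s \<otimes> (b' \<otimes> v))"
    using car c by (simp add: m_ac)
  also have "\<dots> = (t \<otimes> s) \<otimes> ((a \<otimes> b) \<otimes> (u' \<otimes> v'))"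
    unfolding t s using car c by (simp add: m_ac)
  finally show "loc_frac R S (a' \<otimes> b') (u' \<otimes> v') = loc_frac R S (a \<otimes> b) (u \<otimes> v)"
    using car c by (subst loc_frac_eq_iff) auto
qed

lemma loc_add:
  assumes car: "a \<in> carrier R" "u \<in> S" "b \<in> carrier R" "v \<in> S"
  shows "loc_frac R S a u \<oplus>\<^bsub>localization R S\<^esub> loc_frac R S b v =
    loc_frac R S (a \<otimes> v \<oplus> b \<otimes> u) (u \<otimes> v)"
  unfolding localization_def ring.simps
proof (rule Union_representatives[OF car,
    where F = "\<lambda>a u b v. loc_frac R S (a \<otimes> v \<oplus> b \<otimes> u) (u \<otimes> v)"])
  fix a' u' b' v'
  assume "(a', u') \<in> loc_frac R S a u" "(b', v') \<in> loc_frac R S b v"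
  then obtain t s where c: "a' \<in> carrier R" "u' \<in> S" "b' \<in> carrier R" "v' \<in> S" "t \<in> S" "s \<in> S"
    and t: "t \<otimes> (a' \<otimes> u) = t \<otimes> (a \<otimes> u')" and s: "s \<otimes> (b' \<otimes> v) = s \<otimes> (b \<otimes> v')"
    using car by (auto simp: mem_loc_frac_iff loc_frac_eq_iff)
  have "(t \<otimes> s) \<otimes> ((a' \<otimes> v' \<oplus> b' \<otimes> u') \<otimes> (u \<otimes> v)) =
      (s \<otimes> v \<otimes> v') \<otimes> (t \<otimes> (a' \<otimes> u)) \<oplus> (t \<otimes> u \<otimes> u') \<otimes> (s \<otimes> (b' \<otimes> v))"
    using car c by (simp add: m_ac l_distr r_distr)
  also have "\<dots> = (t \<otimes> s) \<otimes> ((a \<otimes> v \<oplus> b \<otimes> u) \<otimes> (u' \<otimes> v'))"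
    unfolding t s using car c by (simp add: m_ac l_distr r_distr)
  finally show "loc_frac R S (a' \<otimes> v' \<oplus> b' \<otimes> u') (u' \<otimes> v') =
      loc_frac R S (a \<otimes> v \<oplus> b \<otimes> u) (u \<otimes> v)"
    using car c by (subst loc_frac_eq_iff) auto
qed

lemma loc_carrier_iff:
  "X \<in> carrier (localization R S) \<longleftrightarrow> (\<exists>a u. a \<in> carrier R \<and> u \<in> S \<and> X = loc_frac R S a u)"
  unfolding localization_def by auto

lemma loc_frac_closed [simp]:
  "a \<in> carrier R \<Longrightarrow> u \<in> S \<Longrightarrow> loc_frac R S a u \<in> carrier (localization R S)"
  by (auto simp: loc_carrier_iff)

lemma loc_one: "\<one>\<^bsub>localization R S\<^esub> = loc_frac R S \<one> \<one>"
  and loc_zero: "\<zero>\<^bsub>localization R S\<^esub> = loc_frac R S \<zero> \<one>"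
  by (simp_all add: localization_def)

text \<open>Ideals are only defined inside rings: if the localization were not a ring, the intersection that
  defines a generated ideal would be over the empty family, and contractions would be trivial.\<close>

lemma cring_localization: "cring (localization R S)"
proof (rule cringI)
  let ?L = "localization R S"
  note fr = loc_carrier_iff loc_add loc_mult loc_one loc_zero
  show "abelian_group ?L"
  proof (rule abelian_groupI)
    fix X Y Z assume "X \<in> carrier ?L" "Y \<in> carrier ?L" "Z \<in> carrier ?L"
    then show "X \<oplus>\<^bsub>?L\<^esub> Y \<oplus>\<^bsub>?L\<^esub> Z = X \<oplus>\<^bsub>?L\<^esub> (Y \<oplus>\<^bsub>?L\<^esub> Z)"
      by (auto simp: fr intro!: loc_frac_eqI del: equalityI subsetI) (simp add: m_ac a_ac l_distr r_distr)
  next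
    fix X Y assume "X \<in> carrier ?L" "Y \<in> carrier ?L"
    then obtain a u b v where "a \<in> carrier R" "u \<in> S" "X = loc_frac R S a u"
      "b \<in> carrier R" "v \<in> S" "Y = loc_frac R S b v"
      by (auto simp: loc_carrier_iff)
    then show "X \<oplus>\<^bsub>?L\<^esub> Y \<in> carrier ?L"
      by (simp add: loc_add)
  next
    fix X assume "X \<in> carrier ?L"
    then obtain a u where X: "a \<in> carrier R" "u \<in> S" "X = loc_frac R S a u"
      by (auto simp: fr)
    then have "loc_frac R S (\<ominus> a) u \<oplus>\<^bsub>?L\<^esub> X = \<zero>\<^bsub>?L\<^esub>"
      by (auto simp: fr l_minus l_neg intro!: loc_frac_eqI del: equalityI subsetI)
    with X show "\<exists>Y\<in>carrier ?L. Y \<oplus>\<^bsub>?L\<^esub> X = \<zero>\<^bsub>?L\<^esub>"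
      by (meson a_inv_closed loc_frac_closed)
  qed (auto simp: fr m_ac a_ac)
  show "comm_monoid ?L"
    by (rule comm_monoidI) (auto simp: fr m_ac, metis S_mult m_closed)
  fix X Y Z assume "X \<in> carrier ?L" "Y \<in> carrier ?L" "Z \<in> carrier ?L"
  then show "(X \<oplus>\<^bsub>?L\<^esub> Y) \<otimes>\<^bsub>?L\<^esub> Z = X \<otimes>\<^bsub>?L\<^esub> Z \<oplus>\<^bsub>?L\<^esub> Y \<otimes>\<^bsub>?L\<^esub> Z"
    by (auto simp: fr intro!: loc_frac_eqI del: equalityI subsetI) (simp add: m_ac a_ac l_distr r_distr)
qed

lemma extended_ideal:
  assumes J: "ideal J R"
  shows "ideal {loc_frac R S a u | a u. a \<in> J \<and> u \<in> S} (localization R S)"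
proof -
  let ?L = "localization R S"
  let ?E = "{loc_frac R S a u | a u. a \<in> J \<and> u \<in> S}"
  interpret J: ideal J R by fact
  interpret L: cring ?L by (rule cring_localization)
  have car: "a \<in> J \<Longrightarrow> a \<in> carrier R" for a by (rule J.Icarr)
  show ?thesis
  proof (rule idealI)
    show "subgroup ?E (add_monoid ?L)"
    proof (rule L.add.subgroupI)
      show "?E \<subseteq> carrier ?L" using car by auto
      show "?E \<noteq> {}" using J.zero_closed S_one by blast
    next
      fix X assume "X \<in> ?E"
      then obtain a u where X: "a \<in> J" "u \<in> S" "X = loc_frac R S a u" by blast
      then have "loc_frac R S (\<ominus> a) u \<oplus>\<^bsub>?L\<^esub> X = \<zero>\<^bsub>?L\<^esub>"
        using car by (auto simp: loc_add loc_zero l_minus l_neg intro!: loc_frac_eqI del: equalityI subsetI)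
      then have "\<ominus>\<^bsub>?L\<^esub> X = loc_frac R S (\<ominus> a) u"
        using X car by (intro L.minus_equality) auto
      with X show "\<ominus>\<^bsub>?L\<^esub> X \<in> ?E" using J.a_inv_closed by blast
    next
      fix X Y assume "X \<in> ?E" "Y \<in> ?E"
      then obtain a u b v where "a \<in> J" "u \<in> S" "X = loc_frac R S a u"
        "b \<in> J" "v \<in> S" "Y = loc_frac R S b v" by blast
      moreover then have "a \<otimes> v \<oplus> b \<otimes> u \<in> J" "u \<otimes> v \<in> S"
        by (simp_all add: J.I_r_closed)
      ultimately show "X \<oplus>\<^bsub>?L\<^esub> Y \<in> ?E"
        using car by (auto simp: loc_add)
    qed
    fix X Y assume "X \<in> ?E" "Y \<in> carrier ?L"
    then obtain a u b v where XY: "a \<in> J" "u \<in> S" "X = loc_frac R S a u"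
      "b \<in> carrier R" "v \<in> S" "Y = loc_frac R S b v" by (auto simp: loc_carrier_iff)
    then have "b \<otimes> a \<in> J" "v \<otimes> u \<in> S" by (simp_all add: J.I_l_closed)
    with XY show "Y \<otimes>\<^bsub>?L\<^esub> X \<in> ?E"
      using car by (auto simp: loc_mult)
    then show "X \<otimes>\<^bsub>?L\<^esub> Y \<in> ?E"
      using XY car by (simp add: L.m_comm)
  qed (rule L.ring_axioms)
qed

text \<open>The fractions with numerator in \<open>J\<close> form an ideal, so the extension of \<open>J\<close> contains nothing else;
  comparing such a fraction with \<open>f/1\<close> yields the multiplier. Conversely \<open>f/1 = (1/t)(tf/1)\<close>.\<close>

lemma mem_extension_iff:
  assumes J: "ideal J R" and f: "f \<in> carrier R"
  shows "loc_frac R S f \<one> \<in> Idl\<^bsub>localization R S\<^esub> ((\<lambda>f. loc_frac R S f \<one>) ` J) \<longleftrightarrow>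
    (\<exists>t\<in>S. t \<otimes> f \<in> J)"
proof
  let ?E = "{loc_frac R S a u | a u. a \<in> J \<and> u \<in> S}"
  interpret J: ideal J R by fact
  have car: "a \<in> J \<Longrightarrow> a \<in> carrier R" for a by (rule J.Icarr)
  {
    assume "loc_frac R S f \<one> \<in> Idl\<^bsub>localization R S\<^esub> ((\<lambda>f. loc_frac R S f \<one>) ` J)"
    moreover have "(\<lambda>f. loc_frac R S f \<one>) ` J \<subseteq> ?E" by auto
    ultimately have "loc_frac R S f \<one> \<in> ?E"
      using extended_ideal[OF J] unfolding genideal_def by blast
    then obtain a u where au: "a \<in> J" "u \<in> S" "loc_frac R S f \<one> = loc_frac R S a u" by blast
    then obtain t where t: "t \<in> S" "t \<otimes> (f \<otimes> u) = t \<otimes> (a \<otimes> \<one>)"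
      using f car by (auto simp: loc_frac_eq_iff)
    then have "(t \<otimes> u) \<otimes> f = t \<otimes> a"
      using au f car by (simp add: m_ac)
    also have "\<dots> \<in> J" using au t by (simp add: J.I_l_closed)
    finally show "\<exists>t\<in>S. t \<otimes> f \<in> J" using au t by blast
  }
  assume "\<exists>t\<in>S. t \<otimes> f \<in> J"
  then obtain t where t: "t \<in> S" "t \<otimes> f \<in> J" by blast
  have eq: "loc_frac R S f \<one> = loc_frac R S \<one> t \<otimes>\<^bsub>localization R S\<^esub> loc_frac R S (t \<otimes> f) \<one>"
    using t f by (auto simp: loc_mult m_ac intro!: loc_frac_eqI del: equalityI subsetI)
  show "loc_frac R S f \<one> \<in> Idl\<^bsub>localization R S\<^esub> ((\<lambda>f. loc_frac R S f \<one>) ` J)"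
    unfolding genideal_def
  proof safe
    fix I assume I: "ideal I (localization R S)" "(\<lambda>f. loc_frac R S f \<one>) ` J \<subseteq> I"
    then show "loc_frac R S f \<one> \<in> I"
      unfolding eq using t by (intro ideal.I_l_closed[OF I(1)]) auto
  qed
qed

end

lemma local_contraction_iff:
  assumes "primeideal P R" "ideal J R"
  shows "f \<in> local_contraction R P J \<longleftrightarrow>
    f \<in> carrier R \<and> (\<exists>t \<in> carrier R - P. t \<otimes>\<^bsub>R\<^esub> f \<in> J)"
proof -
  interpret P: primeideal P R by fact
  interpret multiplicative_subset R "carrier R - P"
  proof
    show "\<one>\<^bsub>R\<^esub> \<in> carrier R - P"
      using P.I_notcarr P.one_imp_carrier by blast
  qed (use P.I_prime in auto)
  show ?thesis
    unfolding local_contraction_def Let_def using mem_extension_iff[OF assms(2)] by blast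
qed

abbreviation lookup :: "('a \<Rightarrow>\<^sub>0 'b::zero) \<Rightarrow> 'a \<Rightarrow> 'b" where "lookup \<equiv> Poly_Mapping.lookup"
abbreviation keys :: "('a \<Rightarrow>\<^sub>0 'b::zero) \<Rightarrow> 'a set" where "keys \<equiv> Poly_Mapping.keys"

section \<open>Polynomial rings\<close>

lemma poly_ring_simps [simp]:
  "p \<in> carrier (poly_ring V) \<longleftrightarrow> (\<forall>m \<in> keys p. keys m \<subseteq> V)"
  "p \<otimes>\<^bsub>poly_ring V\<^esub> q = p * q" "p \<oplus>\<^bsub>poly_ring V\<^esub> q = p + q"
  "\<one>\<^bsub>poly_ring V\<^esub> = 1" "\<zero>\<^bsub>poly_ring V\<^esub> = 0"
  by (auto simp: poly_ring_def)

lemma keys_add_monomial: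
  "keys (a + b :: 'v \<Rightarrow>\<^sub>0 nat) = keys a \<union> keys b"
  by (auto simp: in_keys_iff lookup_add)

lemma keys_mult_subset_carrier:
  assumes "p \<in> carrier (poly_ring V)" "q \<in> carrier (poly_ring V)"
  shows "p * q \<in> carrier (poly_ring V)"
proof -
  have "keys m \<subseteq> V" if "m \<in> keys (p * q)" for m
    using that keys_mult[of p q] assms by (fastforce simp: keys_add_monomial)
  then show ?thesis by simp
qed

lemma cring_poly_ring: "cring (poly_ring V :: ('v, 'k::comm_ring_1) mpoly ring)"
proof (rule cringI)
  let ?R = "poly_ring V :: ('v, 'k) mpoly ring"
  show "abelian_group ?R"
  proof (rule abelian_groupI)
    fix p q assume "p \<in> carrier ?R" "q \<in> carrier ?R"
    then show "p \<oplus>\<^bsub>?R\<^esub> q \<in> carrier ?R"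
      using Poly_Mapping.keys_add[of p q] by auto
  next
    fix p assume "p \<in> carrier ?R"
    then show "\<exists>q\<in>carrier ?R. q \<oplus>\<^bsub>?R\<^esub> p = \<zero>\<^bsub>?R\<^esub>"
      by (intro bexI[of _ "- p"]) (auto simp: in_keys_iff)
  qed (auto simp: algebra_simps)
  show "comm_monoid ?R"
    by (rule comm_monoidI)
      (simp_all add: keys_mult_subset_carrier algebra_simps del: poly_ring_simps(1), auto)
qed (auto simp: algebra_simps)

lemma a_inv_poly_ring [simp]:
  fixes p :: "('v, 'k::comm_ring_1) mpoly"
  assumes "p \<in> carrier (poly_ring V)"
  shows "\<ominus>\<^bsub>poly_ring V\<^esub> p = - p"
proof -
  interpret cring "poly_ring V :: ('v, 'k) mpoly ring" by (rule cring_poly_ring)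
  show ?thesis
    using assms by (intro minus_equality) (auto simp: in_keys_iff)
qed

section \<open>Leading terms without a monomial order\<close>

text \<open>A substitute for leading monomials that needs no order on the variables. One variable at a time,
  keep only the elements of \<open>A\<close> and of \<open>B\<close> whose exponent is maximal: if a sum equals a sum of two
  maximal elements, both its summands must be maximal as well.\<close>

lemma unique_sum_on:
  fixes A B :: "('v \<Rightarrow>\<^sub>0 nat) set"
  assumes "finite W" "finite A" "finite B" "A \<noteq> {}" "B \<noteq> {}"
  shows "\<exists>a\<in>A. \<exists>b\<in>B. \<forall>a'\<in>A. \<forall>b'\<in>B. a' + b' = a + b \<longrightarrow>
    (\<forall>v\<in>W. lookup a' v = lookup a v \<and> lookup b' v = lookup b v)"
  using assms
proof (induction W arbitrary: A B rule: finite_induct)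
  case empty
  then show ?case by auto
next
  case (insert x W)
  define i where "i = Max ((\<lambda>m. lookup m x) ` A)"
  define j where "j = Max ((\<lambda>m. lookup m x) ` B)"
  define A1 where "A1 = {m\<in>A. lookup m x = i}"
  define B1 where "B1 = {m\<in>B. lookup m x = j}"
  have le: "lookup m x \<le> i" if "m \<in> A" for m
    using that insert.prems by (simp add: i_def)
  have le': "lookup m x \<le> j" if "m \<in> B" for m
    using that insert.prems by (simp add: j_def)
  have "i \<in> (\<lambda>m. lookup m x) ` A" "j \<in> (\<lambda>m. lookup m x) ` B"
    using insert.prems unfolding i_def j_def by (intro Max_in; simp)+
  then have "A1 \<noteq> {}" "B1 \<noteq> {}" by (auto simp: A1_def B1_def)
  moreover have "finite A1" "finite B1"
    using insert.prems by (auto simp: A1_def B1_def)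
  ultimately obtain a b where ab: "a \<in> A1" "b \<in> B1" and uniq: "\<And>a' b'. a' \<in> A1 \<Longrightarrow> b' \<in> B1 \<Longrightarrow>
      a' + b' = a + b \<Longrightarrow> (\<forall>v\<in>W. lookup a' v = lookup a v \<and> lookup b' v = lookup b v)"
    using insert.IH[of A1 B1] by metis
  have "\<forall>v\<in>insert x W. lookup a' v = lookup a v \<and> lookup b' v = lookup b v"
    if "a' \<in> A" "b' \<in> B" "a' + b' = a + b" for a' b'
  proof -
    have "lookup a' x + lookup b' x = i + j"
      using arg_cong[OF that(3), of "\<lambda>m. lookup m x"] ab by (simp add: lookup_add A1_def B1_def)
    with le[OF that(1)] le'[OF that(2)] have "lookup a' x = i" "lookup b' x = j" by linarith+
    then have "a' \<in> A1" "b' \<in> B1" using that by (auto simp: A1_def B1_def)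
    with uniq[of a' b'] that have "\<forall>v\<in>W. lookup a' v = lookup a v \<and> lookup b' v = lookup b v"
      by blast
    moreover have "lookup a x = i" "lookup b x = j" using ab by (simp_all add: A1_def B1_def)
    ultimately show ?thesis using \<open>lookup a' x = i\<close> \<open>lookup b' x = j\<close> by simp
  qed
  moreover have "a \<in> A" "b \<in> B" using ab by (simp_all add: A1_def B1_def)
  ultimately show ?case by blast
qed

lemma unique_sum:
  fixes A B :: "('v \<Rightarrow>\<^sub>0 nat) set"
  assumes "finite A" "finite B" "A \<noteq> {}" "B \<noteq> {}"
  obtains a b where "a \<in> A" "b \<in> B"
    and "\<And>a' b'. a' \<in> A \<Longrightarrow> b' \<in> B \<Longrightarrow> a' + b' = a + b \<Longrightarrow> a' = a \<and> b' = b"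
proof -
  define W where "W = (\<Union>m\<in>A \<union> B. keys m)"
  have "finite W" using assms by (auto simp: W_def)
  then obtain a b where ab: "a \<in> A" "b \<in> B"
    and uniq: "\<And>a' b'. a' \<in> A \<Longrightarrow> b' \<in> B \<Longrightarrow> a' + b' = a + b \<Longrightarrow>
      (\<forall>v\<in>W. lookup a' v = lookup a v \<and> lookup b' v = lookup b v)"
    using unique_sum_on[of W A B] assms by metis
  have ext: "m = m'" if "m \<in> A \<union> B" "m' \<in> A \<union> B" "\<forall>v\<in>W. lookup m v = lookup m' v"
    for m m'
  proof (rule poly_mapping_eqI)
    fix v show "lookup m v = lookup m' v"
      using that by (cases "v \<in> W") (auto simp: W_def in_keys_iff)
  qed
  show thesis
  proof (rule that[OF ab])
    fix a' b' assume *: "a' \<in> A" "b' \<in> B" "a' + b' = a + b"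
    from uniq[OF this] show "a' = a \<and> b' = b"
      using ext[of a' a] ext[of b' b] * ab by simp
  qed
qed

text \<open>The coefficient of \<open>pq\<close> at a uniquely represented sum is a single product of nonzero coefficients.
  The subsets \<open>A\<close> and \<open>B\<close> allow the uniqueness to be claimed for selected parts of \<open>p\<close> and \<open>q\<close>, provided
  that the rest cannot produce the same monomials.\<close>

lemma exists_key_mult:
  fixes p q :: "('v, 'k::idom) mpoly"
  assumes A: "A \<subseteq> keys p" "A \<noteq> {}" and B: "B \<subseteq> keys q" "B \<noteq> {}"
    and closed: "\<And>a b a' b'. a \<in> A \<Longrightarrow> b \<in> B \<Longrightarrow> a' \<in> keys p \<Longrightarrow>
      b' \<in> keys q \<Longrightarrow> a' + b' = a + b \<Longrightarrow> a' \<in> A \<and> b' \<in> B"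
  obtains a b where "a \<in> A" "b \<in> B" "a + b \<in> keys (p * q)"
proof -
  have "finite A" "finite B" using A B finite_keys finite_subset by blast+
  then obtain a b where ab: "a \<in> A" "b \<in> B"
    and uniq: "\<And>a' b'. a' \<in> A \<Longrightarrow> b' \<in> B \<Longrightarrow> a' + b' = a + b \<Longrightarrow> a' = a \<and> b' = b"
    using unique_sum A B by metis
  have zero: "lookup p a' * (lookup q b' when a + b = a' + b') = 0" if "a' \<noteq> a" for a' b'
  proof (rule ccontr)
    assume "\<not> ?thesis"
    then have "a' \<in> keys p" "b' \<in> keys q" "a' + b' = a + b"
      by (auto simp: in_keys_iff when_def split: if_splits)
    with closed ab uniq that show False by blast
  qed
  have "lookup (p * q) (a + b) = (\<Sum>l. lookup p l * (\<Sum>b'. lookup q b' when a + b = l + b'))"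
    by (rule lookup_mult)
  also have "\<dots> = (\<Sum>l. (lookup p a * lookup q b) when l = a)"
  proof (rule Sum_any.cong)
    fix l show "lookup p l * (\<Sum>b'. lookup q b' when a + b = l + b') =
      (lookup p a * lookup q b when l = a)"
    proof (cases "l = a")
      case True
      have "(\<Sum>b'. lookup q b' when a + b = a + b') = (\<Sum>b'. lookup q b' when b = b')"
        by (rule Sum_any.cong) (simp add: when_def)
      with True show ?thesis by simp
    next
      case False
      have "(\<Sum>b'. lookup q b' when a + b = l + b') = 0 \<or> lookup p l = 0"
        using zero[OF False] by (cases "lookup p l = 0") simp_all
      with False show ?thesis by auto
    qed
  qed
  also have "\<dots> = lookup p a * lookup q b" by simp
  finally have "a + b \<in> keys (p * q)"
    using ab A B by (auto simp: in_keys_iff)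
  with ab show thesis by (rule that)
qed

section \<open>Monomial ideals\<close>

definition multiples :: "('v \<Rightarrow>\<^sub>0 nat) set \<Rightarrow> ('v \<Rightarrow>\<^sub>0 nat) set" where
  "multiples G = {g + d | g d. g \<in> G}"

lemma mem_multiples_iff:
  "m \<in> multiples G \<longleftrightarrow> (\<exists>g\<in>G. \<forall>v. lookup g v \<le> lookup m v)"
proof
  assume "\<exists>g\<in>G. \<forall>v. lookup g v \<le> lookup m v"
  then obtain g where "g \<in> G" "\<forall>v. lookup g v \<le> lookup m v" by blast
  then have "m = g + (m - g)"
    by (intro poly_mapping_eqI) (simp add: lookup_add lookup_minus)
  with \<open>g \<in> G\<close> show "m \<in> multiples G" unfolding multiples_def by blast
next
  assume "m \<in> multiples G"
  then obtain g d where "g \<in> G" "m = g + d" unfolding multiples_def by blast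
  then show "\<exists>g\<in>G. \<forall>v. lookup g v \<le> lookup m v"
    by (intro bexI[of _ g]) (simp_all add: lookup_add)
qed

lemma multiples_add:
  assumes "m \<in> multiples G"
  shows "m + d \<in> multiples G" "d + m \<in> multiples G"
proof -
  show "m + d \<in> multiples G"
    using assms unfolding multiples_def by (smt (verit) add.assoc mem_Collect_eq)
  then show "d + m \<in> multiples G" by (simp add: add.commute)
qed

definition monomial_ideal :: "'v set \<Rightarrow> ('v \<Rightarrow>\<^sub>0 nat) set \<Rightarrow> ('v, 'k::comm_ring_1) mpoly set" where
  "monomial_ideal V G = {p \<in> carrier (poly_ring V). keys p \<subseteq> multiples G}"

lemma ideal_monomial_ideal:
  "ideal (monomial_ideal V G :: ('v, 'k::comm_ring_1) mpoly set) (poly_ring V)"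
proof -
  let ?R = "poly_ring V :: ('v, 'k) mpoly ring" and ?I = "monomial_ideal V G :: ('v, 'k) mpoly set"
  interpret R: cring ?R by (rule cring_poly_ring)
  have mult: "q * p \<in> ?I" if "p \<in> ?I" "q \<in> carrier ?R" for p q
  proof -
    have "m \<in> multiples G" if m: "m \<in> keys (q * p)" for m
    proof -
      obtain a b where "m = a + b" "b \<in> keys p" using m keys_mult[of q p] by blast
      then show ?thesis
        using \<open>p \<in> ?I\<close> multiples_add(2)[of b] unfolding monomial_ideal_def by blast
    qed
    then show ?thesis
      using that keys_mult_subset_carrier unfolding monomial_ideal_def by blast
  qed
  show ?thesis
  proof (rule idealI)
    show "subgroup ?I (add_monoid ?R)"
    proof (rule R.add.subgroupI)
      show "?I \<noteq> {}" by (auto simp: monomial_ideal_def intro: exI[of _ 0])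
    next
      fix p q assume pq: "p \<in> ?I" "q \<in> ?I"
      then have "p \<oplus>\<^bsub>?R\<^esub> q \<in> carrier ?R"
        unfolding monomial_ideal_def by (intro R.a_closed) blast+
      moreover have "keys (p + q) \<subseteq> multiples G"
        using pq Poly_Mapping.keys_add[of p q] unfolding monomial_ideal_def by blast
      ultimately show "p \<oplus>\<^bsub>?R\<^esub> q \<in> ?I"
        unfolding monomial_ideal_def by simp
    next
      fix p assume "p \<in> ?I"
      then show "\<ominus>\<^bsub>?R\<^esub> p \<in> ?I"
        by (auto simp: monomial_ideal_def in_keys_iff subset_iff)
    qed (auto simp: monomial_ideal_def)
  qed (use mult in \<open>simp_all add: R.ring_axioms mult.commute\<close>)
qed

lemma poly_eq_sum_monomials:
  fixes p :: "('v, 'k::comm_ring_1) mpoly"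
  shows "p = (\<Sum>m\<in>keys p. Poly_Mapping.single m (lookup p m))"
proof (rule poly_mapping_eqI)
  fix k
  show "lookup p k = lookup (\<Sum>m\<in>keys p. Poly_Mapping.single m (lookup p m)) k"
    by (simp add: lookup_sum lookup_single when_def in_keys_iff)
qed

text \<open>A polynomial is the sum of its terms, so an additively closed set need only contain the terms.\<close>

lemma monomial_ideal_subset:
  fixes J :: "('v, 'k::comm_ring_1) mpoly set"
  assumes zero: "0 \<in> J" and add: "\<And>p q. p \<in> J \<Longrightarrow> q \<in> J \<Longrightarrow> p + q \<in> J"
    and mono: "\<And>m c. m \<in> multiples G \<Longrightarrow> keys m \<subseteq> V \<Longrightarrow> Poly_Mapping.single m c \<in> J"
  shows "monomial_ideal V G \<subseteq> J"
proof
  fix p :: "('v, 'k) mpoly" assume p: "p \<in> monomial_ideal V G"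
  have "(\<Sum>m\<in>K. Poly_Mapping.single m (lookup p m)) \<in> J"
    if "finite K" "K \<subseteq> keys p" for K
    using that
  proof (induction K rule: finite_induct)
    case (insert m K)
    then have "Poly_Mapping.single m (lookup p m) \<in> J"
      using p by (intro mono) (auto simp: monomial_ideal_def)
    with insert show ?case by (simp add: add)
  qed (simp add: zero)
  from this[of "keys p"] show "p \<in> J"
    by (simp flip: poly_eq_sum_monomials)
qed

lemma genideal_monomials:
  assumes "\<And>g. g \<in> G \<Longrightarrow> keys g \<subseteq> V"
  shows "Idl\<^bsub>poly_ring V\<^esub> {Poly_Mapping.single g (1 :: 'k::comm_ring_1) | g. g \<in> G} = monomial_ideal V G"
    (is "Idl\<^bsub>?R\<^esub> ?M = _")
proof
  interpret R: cring ?R by (rule cring_poly_ring)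
  have M: "?M \<subseteq> carrier ?R" using assms by auto
  have "?M \<subseteq> monomial_ideal V G"
    using assms[THEN subsetD] by (auto simp: monomial_ideal_def mem_multiples_iff)
  then show "Idl\<^bsub>?R\<^esub> ?M \<subseteq> monomial_ideal V G"
    by (rule R.genideal_minimal[OF ideal_monomial_ideal])
  interpret J: ideal "Idl\<^bsub>?R\<^esub> ?M" ?R by (rule R.genideal_ideal[OF M])
  show "monomial_ideal V G \<subseteq> Idl\<^bsub>?R\<^esub> ?M"
  proof (rule monomial_ideal_subset)
    fix m and c :: 'k assume "m \<in> multiples G" "keys m \<subseteq> V"
    then obtain g d where g: "g \<in> G" "m = g + d" "keys d \<subseteq> V"
      by (auto simp: multiples_def keys_add_monomial)
    then have "Poly_Mapping.single d c \<otimes>\<^bsub>?R\<^esub> Poly_Mapping.single g 1 \<in> Idl\<^bsub>?R\<^esub> ?M"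
      using R.genideal_self[OF M] by (intro J.I_l_closed) (auto split: if_splits)
    then show "Poly_Mapping.single m c \<in> Idl\<^bsub>?R\<^esub> ?M"
      using g by (simp add: mult_single add.commute)
  qed (use J.zero_closed J.a_closed in simp_all)
qed

lemma ideal_prod_monomial_ideals:
  assumes "\<And>g. g \<in> G \<Longrightarrow> keys g \<subseteq> V"
  shows "ideal_prod (poly_ring V) (monomial_ideal V G) (monomial_ideal V H) =
    (monomial_ideal V {g + h | g h. g \<in> G \<and> h \<in> H} :: ('v, 'k::comm_ring_1) mpoly set)"
    (is "ideal_prod ?R ?I ?J = monomial_ideal V ?GH")
proof
  interpret R: cring ?R by (rule cring_poly_ring)
  interpret K: ideal "monomial_ideal V ?GH" ?R by (rule ideal_monomial_ideal)
  show "ideal_prod ?R ?I ?J \<subseteq> monomial_ideal V ?GH"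
  proof
    fix p assume "p \<in> ideal_prod ?R ?I ?J"
    then show "p \<in> monomial_ideal V ?GH"
    proof induction
      case (prod p q)
      have "m \<in> multiples ?GH" if m: "m \<in> keys (p * q)" for m
      proof -
        obtain a b where ab: "m = a + b" "a \<in> keys p" "b \<in> keys q"
          using m keys_mult[of p q] by blast
        then have "a \<in> multiples G" "b \<in> multiples H"
          using prod unfolding monomial_ideal_def by blast+
        then obtain g h d e where gh: "g \<in> G" "h \<in> H" "a = g + d" "b = h + e"
          unfolding multiples_def by blast
        then have "m = (g + h) + (d + e)" using ab by (simp add: algebra_simps)
        then show ?thesis using gh unfolding multiples_def by blast
      qed
      moreover have "p * q \<in> carrier (poly_ring V)"
        using prod keys_mult_subset_carrier unfolding monomial_ideal_def by blast
      ultimately show ?case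
        unfolding monomial_ideal_def by (simp add: subset_iff)
    next
      case (sum p q)
      show ?case by (rule K.a_closed[OF sum.IH])
    qed
  qed
  interpret P: ideal "ideal_prod ?R ?I ?J" ?R
    by (intro R.ideal_prod_is_ideal ideal_monomial_ideal)
  show "monomial_ideal V ?GH \<subseteq> ideal_prod ?R ?I ?J"
  proof (rule monomial_ideal_subset)
    fix m and c :: 'k assume "m \<in> multiples ?GH" "keys m \<subseteq> V"
    then obtain g h d where gh: "g \<in> G" "h \<in> H" and "m = (g + h) + d"
      unfolding multiples_def by blast
    then have m: "m = g + (h + d)" by (simp add: add.assoc)
    have "g + 0 \<in> multiples G" "h + d \<in> multiples H"
      using gh unfolding multiples_def by blast+
    moreover have "keys g \<subseteq> V" "keys (h + d) \<subseteq> V"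
      using \<open>keys m \<subseteq> V\<close> unfolding m keys_add_monomial by simp_all
    ultimately have "Poly_Mapping.single g 1 \<in> ?I" "Poly_Mapping.single (h + d) c \<in> ?J"
      by (simp_all add: monomial_ideal_def)
    then have "Poly_Mapping.single g 1 \<otimes>\<^bsub>?R\<^esub> Poly_Mapping.single (h + d) c \<in> ideal_prod ?R ?I ?J"
      by (rule ideal_prod.prod)
    then show "Poly_Mapping.single m c \<in> ideal_prod ?R ?I ?J"
      by (simp add: m mult_single)
  qed (use P.zero_closed P.a_closed in simp_all)
qed

text \<open>In exponents, the products of \<open>s\<close> monomials from \<open>G\<close>, with repetition.\<close>

fun sums_of :: "('v \<Rightarrow>\<^sub>0 nat) set \<Rightarrow> nat \<Rightarrow> ('v \<Rightarrow>\<^sub>0 nat) set" where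
  "sums_of G 0 = {0}"
| "sums_of G (Suc s) = {a + g | a g. a \<in> sums_of G s \<and> g \<in> G}"

lemma keys_sums_of:
  assumes "\<And>g. g \<in> G \<Longrightarrow> keys g \<subseteq> V" "t \<in> sums_of G s"
  shows "keys t \<subseteq> V"
  using assms(2)
proof (induction s arbitrary: t)
  case (Suc s)
  then obtain a g where "t = a + g" "a \<in> sums_of G s" "g \<in> G" by auto
  with Suc.IH[of a] assms(1)[of g] show ?case by (simp add: keys_add_monomial)
qed simp

lemma ideal_power_monomial_ideal:
  assumes "\<And>g. g \<in> G \<Longrightarrow> keys g \<subseteq> V"
  shows "ideal_power (poly_ring V) (monomial_ideal V G) s =
    (monomial_ideal V (sums_of G s) :: ('v, 'k::comm_ring_1) mpoly set)"
proof (induction s)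
  case 0
  have "multiples {0 :: 'v \<Rightarrow>\<^sub>0 nat} = UNIV" by (simp add: multiples_def)
  then show ?case
    by (simp add: ideals_set_def monomial_ideal_def nat_pow_def del: poly_ring_simps(1))
next
  case (Suc s)
  have "ideal_prod (poly_ring V) (monomial_ideal V (sums_of G s)) (monomial_ideal V G) =
      (monomial_ideal V (sums_of G (Suc s)) :: ('v, 'k) mpoly set)"
    unfolding sums_of.simps by (rule ideal_prod_monomial_ideals) (rule keys_sums_of[OF assms])
  with Suc show ?case
    by (simp add: ideals_set_def nat_pow_def del: sums_of.simps)
qed

section \<open>Monomial primes\<close>

text \<open>The ideal of \<open>k[V]\<close> generated by the variables in \<open>C \<inter> V\<close>.\<close>

definition variable_prime :: "'v set \<Rightarrow> 'v set \<Rightarrow> ('v, 'k::comm_ring_1) mpoly set" where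
  "variable_prime V C = monomial_ideal V ((\<lambda>v. Poly_Mapping.single v 1) ` C)"

lemma mem_variable_prime_iff:
  fixes p :: "('v, 'k::comm_ring_1) mpoly"
  shows "p \<in> variable_prime V C \<longleftrightarrow> p \<in> carrier (poly_ring V) \<and> (\<forall>m\<in>keys p. keys m \<inter> C \<noteq> {})"
proof -
  have "m \<in> multiples ((\<lambda>v. Poly_Mapping.single v 1) ` C) \<longleftrightarrow> keys m \<inter> C \<noteq> {}" for m :: "'v \<Rightarrow>\<^sub>0 nat"
  proof -
    have "(\<forall>w. lookup (Poly_Mapping.single v 1) w \<le> lookup m w) \<longleftrightarrow> v \<in> keys m" for v
      by (auto simp: lookup_single when_def in_keys_iff Suc_le_eq)
    then show ?thesis by (auto simp: mem_multiples_iff)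
  qed
  then show ?thesis unfolding variable_prime_def monomial_ideal_def by auto
qed

text \<open>Outside the ideal a polynomial has a monomial avoiding \<open>C\<close>. A product of two such monomials avoids
  \<open>C\<close> and can only arise from monomials avoiding \<open>C\<close>, so \<open>exists_key_mult\<close> applies to these parts of
  the two factors.\<close>

lemma primeideal_variable_prime:
  "primeideal (variable_prime V C :: ('v, 'k::idom) mpoly set) (poly_ring V)"
proof (rule primeidealI)
  show "ideal (variable_prime V C :: ('v, 'k) mpoly set) (poly_ring V)"
    unfolding variable_prime_def by (rule ideal_monomial_ideal)
  show "carrier (poly_ring V) \<noteq> (variable_prime V C :: ('v, 'k) mpoly set)"
  proof
    assume "carrier (poly_ring V) = (variable_prime V C :: ('v, 'k) mpoly set)"
    then have "(1 :: ('v, 'k) mpoly) \<in> variable_prime V C"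
      by (metis cring_poly_ring cring_def ring.ring_simprules(6) poly_ring_simps(4))
    then show False by (simp add: mem_variable_prime_iff)
  qed
  fix p q :: "('v, 'k) mpoly"
  assume car: "p \<in> carrier (poly_ring V)" "q \<in> carrier (poly_ring V)"
    and pq: "p \<otimes>\<^bsub>poly_ring V\<^esub> q \<in> variable_prime V C"
  show "p \<in> variable_prime V C \<or> q \<in> variable_prime V C"
  proof (rule ccontr)
    assume "\<not> ?thesis"
    then have A: "{m\<in>keys p. keys m \<inter> C = {}} \<noteq> {}" and B: "{m\<in>keys q. keys m \<inter> C = {}} \<noteq> {}"
      using car unfolding mem_variable_prime_iff by auto
    obtain a b where ab: "keys a \<inter> C = {}" "keys b \<inter> C = {}" "a + b \<in> keys (p * q)"
    proof (rule exists_key_mult[OF _ A _ B])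
      fix a b a' b'
      assume "a \<in> {m\<in>keys p. keys m \<inter> C = {}}" "b \<in> {m\<in>keys q. keys m \<inter> C = {}}"
        "a' \<in> keys p" "b' \<in> keys q" "a' + b' = a + b"
      moreover from this have "keys a' \<union> keys b' = keys a \<union> keys b"
        by (metis keys_add_monomial)
      ultimately show "a' \<in> {m\<in>keys p. keys m \<inter> C = {}} \<and> b' \<in> {m\<in>keys q. keys m \<inter> C = {}}"
        by auto
    qed auto
    with pq have "keys (a + b) \<inter> C \<noteq> {}" by (simp add: mem_variable_prime_iff)
    with ab show False by (auto simp: keys_add_monomial)
  qed
qed (rule cring_poly_ring)

text \<open>The multiplier \<open>t\<close> is an arbitrary polynomial outside the prime, but for a monomial ideal it can be
  replaced by a monomial, chosen separately for each monomial of \<open>F\<close>. If this failed, take the bad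
  monomials of \<open>F\<close> of least degree in \<open>C\<close> and the monomials of \<open>t\<close> avoiding \<open>C\<close>: their products cannot be
  produced in any other way, so one of them survives in \<open>tF\<close>, lies in the monomial ideal, and shows
  that the bad monomial was not bad.\<close>

lemma contraction_monomialwise:
  fixes t F :: "('v, 'k::idom) mpoly"
  assumes V: "finite V"
    and t: "t \<in> carrier (poly_ring V)" "t \<notin> variable_prime V C"
    and F: "F \<in> carrier (poly_ring V)"
    and tF: "t * F \<in> monomial_ideal V G"
    and u: "u \<in> keys F"
  shows "\<exists>m. keys m \<subseteq> V - C \<and> u + m \<in> multiples G"
proof (rule ccontr)
  define Q where "Q u \<longleftrightarrow> (\<exists>m. keys m \<subseteq> V - C \<and> u + m \<in> multiples G)" for u
  define cdeg where "cdeg m = (\<Sum>v\<in>V \<inter> C. lookup m v)" for m :: "'v \<Rightarrow>\<^sub>0 nat"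
  have cdeg_add: "cdeg (m + m') = cdeg m + cdeg m'" for m m'
    by (simp add: cdeg_def lookup_add sum.distrib)
  have cdeg_0: "cdeg m = 0 \<longleftrightarrow> keys m \<inter> C = {}" if "keys m \<subseteq> V" for m
    using that V by (auto simp: cdeg_def in_keys_iff)
  assume "\<not> ?thesis"
  then have "u \<in> keys F \<and> \<not> Q u" using u by (simp add: Q_def)
  then obtain b0 where b0: "b0 \<in> keys F" "\<not> Q b0"
    and min: "\<And>b. b \<in> keys F \<Longrightarrow> \<not> Q b \<Longrightarrow> cdeg b0 \<le> cdeg b"
    using ex_has_least_nat[of "\<lambda>b. b \<in> keys F \<and> \<not> Q b" u cdeg] by blast
  define A where "A = {a\<in>keys t. keys a \<inter> C = {}}"
  define B where "B = {b\<in>keys F. \<not> Q b \<and> cdeg b = cdeg b0}"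
  have "A \<noteq> {}" using t unfolding mem_variable_prime_iff A_def by auto
  moreover have "B \<noteq> {}" using b0 by (auto simp: B_def)
  moreover have "a' \<in> A \<and> b' \<in> B"
    if "a \<in> A" "b \<in> B" "a' \<in> keys t" "b' \<in> keys F" "a' + b' = a + b" for a b a' b'
  proof -
    have a: "keys a \<subseteq> V - C" "keys a' \<subseteq> V" using that t by (auto simp: A_def)
    have "\<not> Q b'"
    proof
      assume "Q b'"
      then obtain m where m: "keys m \<subseteq> V - C" "b' + m \<in> multiples G" by (auto simp: Q_def)
      have "a' + (b' + m) \<in> multiples G" using m(2) by (rule multiples_add(2))
      then have "b + (a + m) \<in> multiples G" using that(5) by (metis add.assoc add.commute)
      moreover have "keys (a + m) \<subseteq> V - C" using a m by (simp add: keys_add_monomial)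
      ultimately have "Q b" unfolding Q_def by blast
      with that show False by (simp add: B_def)
    qed
    moreover have "cdeg a' + cdeg b' = cdeg b0"
      using that(2) arg_cong[OF that(5), of cdeg] cdeg_0[of a] a by (auto simp: cdeg_add B_def)
    ultimately have "cdeg a' = 0" "cdeg b' = cdeg b0"
      using min[of b'] that by auto
    then show ?thesis
      using that \<open>\<not> Q b'\<close> cdeg_0[of a'] a by (auto simp: A_def B_def)
  qed
  moreover have "A \<subseteq> keys t" "B \<subseteq> keys F" by (auto simp: A_def B_def)
  ultimately obtain a b where "a \<in> A" "b \<in> B" "a + b \<in> keys (t * F)"
    using exists_key_mult[of A t B F] by metis
  then have "b + a \<in> multiples G" "keys a \<subseteq> V - C" "\<not> Q b"
    using tF t by (auto simp: monomial_ideal_def A_def B_def add.commute)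
  then show False unfolding Q_def by blast
qed

section \<open>Associated primes of monomial ideals\<close>

lemma keys_monomial_mult:
  fixes p :: "('v, 'k::idom) mpoly"
  assumes "k \<in> keys p"
  shows "m + k \<in> keys (Poly_Mapping.single m 1 * p)"
  by (rule exists_key_mult[of "{m}" "Poly_Mapping.single m 1" "{k}" p]) (use assms in auto)

lemma monomial_ideal_iff:
  "p \<in> monomial_ideal V G \<longleftrightarrow> p \<in> carrier (poly_ring V) \<and> keys p \<subseteq> multiples G"
  by (simp add: monomial_ideal_def)

text \<open>Multiply \<open>h\<^sub>0\<close> by variables as long as the product stays outside the ideal, but stop an exponent at a
  bound \<open>top\<close> beyond which no generator sees it. In a maximal such monomial \<open>h\<close> every variable either is
  at its bound, so that more of it never brings \<open>h\<close> into the ideal, or brings \<open>h\<close> into the ideal at once. Hence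
  the annihilator of \<open>h\<close> modulo the ideal is generated by the variables of the second kind, and these
  include each variable with a power that multiplies \<open>h\<^sub>0\<close> into the ideal.\<close>

lemma exists_associated_prime:
  assumes V: "finite V"
    and keys_G: "\<And>g. g \<in> G \<Longrightarrow> keys g \<subseteq> V"
    and bound: "\<And>g v. g \<in> G \<Longrightarrow> lookup g v \<le> B v"
    and h0: "keys h0 \<subseteq> V" "h0 \<notin> multiples G"
  obtains C where
    "(variable_prime V C :: ('v, 'k::idom) mpoly set) \<in> associated_primes (poly_ring V) (monomial_ideal V G)"
    "\<And>v N. v \<in> V \<Longrightarrow> h0 + Poly_Mapping.single v N \<in> multiples G \<Longrightarrow> v \<in> C"
proof -
  define top where "top v = max (B v) (lookup h0 v)" for v
  define ok where "ok h \<longleftrightarrow> keys h \<subseteq> V \<and> h \<notin> multiples G \<and>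
    (\<forall>v. lookup h0 v \<le> lookup h v) \<and> (\<forall>v\<in>V. lookup h v \<le> top v)" for h
  \<comment> \<open>total degree: bounded on the admissible monomials, hence maximal somewhere\<close>
  define deg where "deg h = (\<Sum>v\<in>V. lookup h v)" for h :: "'v \<Rightarrow>\<^sub>0 nat"
  have "ok h0" using h0 by (simp add: ok_def top_def)
  moreover have "deg h \<le> (\<Sum>v\<in>V. top v)" if "ok h" for h
    using that unfolding deg_def ok_def by (intro sum_mono) blast
  ultimately obtain h where h: "ok h" and maximal: "\<And>h'. ok h' \<Longrightarrow> deg h' \<le> deg h"
    using Lattices_Big.ex_has_greatest_nat[of ok h0 deg "Suc (\<Sum>v\<in>V. top v)"]
    by (auto simp: less_Suc_eq_le)
  define C where "C = {v\<in>V. h + Poly_Mapping.single v 1 \<in> multiples G}"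
  have saturated: "lookup h v = top v" if "v \<in> V - C" for v
  proof (rule ccontr)
    assume "lookup h v \<noteq> top v"
    with h that have "ok (h + Poly_Mapping.single v 1)"
      unfolding ok_def C_def
      by (auto simp: lookup_add lookup_single when_def keys_add_monomial split: if_splits
          intro: le_SucI dest: order.not_eq_order_implies_strict)
    then have "deg (h + Poly_Mapping.single v 1) \<le> deg h" by (rule maximal)
    moreover have "deg (h + Poly_Mapping.single v 1) = Suc (deg h)"
      using V that by (simp add: deg_def lookup_add sum.distrib lookup_single when_def)
    ultimately show False by simp
  qed
  have colon: "m + h \<in> multiples G \<longleftrightarrow> keys m \<inter> C \<noteq> {}" if m: "keys m \<subseteq> V" for m
  proof
    assume "keys m \<inter> C \<noteq> {}"
    then obtain v where v: "v \<in> keys m" "v \<in> C" by blast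
    then have "m = (m - Poly_Mapping.single v 1) + Poly_Mapping.single v 1"
      by (intro poly_mapping_eqI) (auto simp: lookup_add lookup_minus lookup_single when_def in_keys_iff)
    then have "m + h = (m - Poly_Mapping.single v 1) + (h + Poly_Mapping.single v 1)"
      by (metis add.assoc add.commute)
    with v show "m + h \<in> multiples G" by (simp add: C_def multiples_add)
  next
    assume "m + h \<in> multiples G"
    then obtain f where f: "f \<in> G" "\<And>v. lookup f v \<le> lookup m v + lookup h v"
      by (auto simp: mem_multiples_iff lookup_add)
    show "keys m \<inter> C \<noteq> {}"
    proof
      assume disj: "keys m \<inter> C = {}"
      have "lookup f v \<le> lookup h v" for v
      proof (cases "v \<in> keys m")
        case True
        then have "lookup h v = top v" using saturated m disj by blast
        then show ?thesis using bound[OF f(1), of v] by (simp add: top_def)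
      next
        case False
        then show ?thesis using f(2)[of v] by (simp add: in_keys_iff)
      qed
      with f h show False by (auto simp: ok_def mem_multiples_iff)
    qed
  qed
  let ?h = "Poly_Mapping.single h (1::'k)"
  have h_car: "?h \<in> carrier (poly_ring V)" using h by (simp add: ok_def)
  have "g * ?h \<in> monomial_ideal V G \<longleftrightarrow> g \<in> variable_prime V C"
    if g: "g \<in> carrier (poly_ring V)" for g :: "('v, 'k) mpoly"
  proof -
    have "keys (g * ?h) = (\<lambda>m. m + h) ` keys g"
    proof
      show "keys (g * ?h) \<subseteq> (\<lambda>m. m + h) ` keys g" using keys_mult[of g ?h] by auto
      show "(\<lambda>m. m + h) ` keys g \<subseteq> keys (g * ?h)"
        using keys_monomial_mult[of _ g h] by (auto simp: mult.commute add.commute)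
    qed
    then show ?thesis
      using g keys_mult_subset_carrier[OF g h_car] colon
      unfolding monomial_ideal_iff mem_variable_prime_iff by auto
  qed
  then have "variable_prime V C = {g \<in> carrier (poly_ring V). g \<otimes>\<^bsub>poly_ring V\<^esub> ?h \<in> monomial_ideal V G}"
    unfolding set_eq_iff mem_Collect_eq poly_ring_simps(2)
    by (metis mem_variable_prime_iff)
  moreover have "primeideal (variable_prime V C :: ('v, 'k) mpoly set) (poly_ring V)"
    by (rule primeideal_variable_prime)
  ultimately have "(variable_prime V C :: ('v, 'k) mpoly set)
      \<in> associated_primes (poly_ring V) (monomial_ideal V G)"
    using h_car unfolding associated_primes_def by blast
  moreover have "v \<in> C" if v: "v \<in> V" "h0 + Poly_Mapping.single v N \<in> multiples G" for v N
  proof (rule ccontr)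
    assume "v \<notin> C"
    then have top: "lookup h v = top v" using saturated v by blast
    obtain f where f: "f \<in> G" "\<And>x. lookup f x \<le> lookup (h0 + Poly_Mapping.single v N) x"
      using v by (auto simp: mem_multiples_iff)
    have "lookup f x \<le> lookup h x" for x
    proof (cases "x = v")
      case True
      then show ?thesis using bound[OF f(1), of v] top by (simp add: top_def)
    next
      case False
      then have "lookup f x \<le> lookup h0 x"
        using f(2)[of x] by (simp add: lookup_add lookup_single)
      also have "\<dots> \<le> lookup h x" using h by (simp add: ok_def)
      finally show ?thesis .
    qed
    with f h show False by (auto simp: ok_def mem_multiples_iff)
  qed
  ultimately show thesis using that by blast
qed

lemma variable_in_prime:
  fixes P :: "('v, 'k::comm_ring_1) mpoly set"
  assumes V: "finite V" and P: "primeideal P (poly_ring V)"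
    and m: "keys m \<subseteq> V" "Poly_Mapping.single m 1 \<in> P"
  shows "\<exists>v\<in>keys m. pvar v \<in> P"
  using m
proof (induction "\<Sum>v\<in>V. lookup m v" arbitrary: m rule: less_induct)
  case less
  interpret P: primeideal P "poly_ring V" by fact
  show ?case
  proof (cases "m = 0")
    case True
    then have "\<one>\<^bsub>poly_ring V\<^esub> \<in> P" using less.prems by simp
    then have "carrier (poly_ring V) = P" by (metis P.one_imp_carrier)
    with P.I_notcarr show ?thesis by simp
  next
    case False
    then obtain v where v: "v \<in> keys m" by (metis keys_eq_empty equals0I)
    define m' where "m' = m - Poly_Mapping.single v 1"
    have m: "m = Poly_Mapping.single v 1 + m'" unfolding m'_def using v
      by (intro poly_mapping_eqI) (auto simp: lookup_add lookup_minus lookup_single when_def in_keys_iff)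
    have "pvar v \<otimes>\<^bsub>poly_ring V\<^esub> Poly_Mapping.single m' 1 \<in> P"
      using less.prems by (simp add: pvar_def mult_single m)
    moreover have k: "keys m = insert v (keys m')" by (simp add: m keys_add_monomial)
    ultimately consider "pvar v \<in> P" | "Poly_Mapping.single m' 1 \<in> P"
      using P.I_prime[of "pvar v" "Poly_Mapping.single m' 1"] less.prems by (auto simp: pvar_def)
    then show ?thesis
    proof cases
      case 2
      have "(\<Sum>v\<in>V. lookup m' v) < (\<Sum>v\<in>V. lookup m v)"
        using V less.prems k
        by (simp add: m lookup_add sum.distrib lookup_single when_def)
      with 2 less.hyps[of m'] less.prems k show ?thesis by auto
    qed (use v in blast)
  qed
qed

text \<open>If \<open>P\<close> is the annihilator of \<open>f\<close> modulo the ideal, it is also that of \<open>qf\<close> for \<open>q\<close> outside \<open>P\<close>. Any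
  monomial of \<open>qf\<close> outside the ideal is then a witness divisible by \<open>q\<close>; it has the stated properties
  because the ideal is monomial.\<close>

lemma associated_prime_witness:
  fixes P :: "('v, 'k::idom) mpoly set"
  assumes V: "finite V" and P: "P \<in> associated_primes (poly_ring V) (monomial_ideal V G)"
    and q: "keys q \<subseteq> V" "\<And>v. v \<in> keys q \<Longrightarrow> pvar v \<notin> P"
  obtains g where "keys g \<subseteq> V" "g \<notin> multiples G" "\<And>v. lookup q v \<le> lookup g v"
    "\<And>v. v \<in> V \<Longrightarrow> pvar v \<in> P \<Longrightarrow> g + Poly_Mapping.single v 1 \<in> multiples G"
proof -
  let ?R = "poly_ring V :: ('v, 'k) mpoly ring" and ?I = "monomial_ideal V G :: ('v, 'k) mpoly set"
  let ?q = "Poly_Mapping.single q (1::'k)"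
  obtain f where prime: "primeideal P ?R" and f: "f \<in> carrier ?R"
    and P_eq: "P = {g \<in> carrier ?R. g * f \<in> ?I}"
    using P by (auto simp: associated_primes_def)
  have q_car: "?q \<in> carrier ?R" using q by simp
  moreover have "?q \<notin> P" using variable_in_prime[OF V prime] q by blast
  ultimately have "?q * f \<notin> ?I" by (simp add: P_eq)
  then obtain g where g: "g \<in> keys (?q * f)" "g \<notin> multiples G"
    using keys_mult_subset_carrier[OF q_car f] unfolding monomial_ideal_iff by blast
  show thesis
  proof (rule that[OF _ g(2)])
    show "keys g \<subseteq> V" using keys_mult_subset_carrier[OF q_car f] g by simp
    show "lookup q v \<le> lookup g v" for v
      using g keys_mult[of ?q f] by (auto simp: lookup_add)
    fix v assume "v \<in> V" "pvar v \<in> P"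
    then have "pvar v * f \<in> ?I" by (simp add: P_eq)
    then have "?q \<otimes>\<^bsub>?R\<^esub> (pvar v * f) \<in> ?I"
      using q_car by (intro ideal.I_l_closed[OF ideal_monomial_ideal])
    then have "pvar v * (?q * f) \<in> ?I" by (simp add: mult.left_commute)
    moreover have "Poly_Mapping.single v 1 + g \<in> keys (pvar v * (?q * f))"
      unfolding pvar_def by (rule keys_monomial_mult[OF g(1)])
    ultimately show "g + Poly_Mapping.single v 1 \<in> multiples G"
      by (auto simp: monomial_ideal_iff add.commute)
  qed
qed

section \<open>Symbolic powers of monomial ideals\<close>

lemma ideal_ideal_power:
  assumes "\<And>g. g \<in> G \<Longrightarrow> keys g \<subseteq> V"
  shows "ideal (ideal_power (poly_ring V) (monomial_ideal V G :: ('v, 'k::comm_ring_1) mpoly set) s) (poly_ring V)"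
  by (subst ideal_power_monomial_ideal) (use assms ideal_monomial_ideal in auto)

lemma ideal_power_subset_symbolic_power:
  assumes "\<And>g. g \<in> G \<Longrightarrow> keys g \<subseteq> V"
  shows "ideal_power (poly_ring V) (monomial_ideal V G :: ('v, 'k::comm_ring_1) mpoly set) s
    \<subseteq> symbolic_power (poly_ring V) (monomial_ideal V G) s"
proof
  fix f :: "('v, 'k) mpoly"
  let ?R = "poly_ring V :: ('v, 'k) mpoly ring" and ?I = "monomial_ideal V G :: ('v, 'k) mpoly set"
  interpret R: cring ?R by (rule cring_poly_ring)
  interpret J: ideal "ideal_power ?R ?I s" ?R by (rule ideal_ideal_power[OF assms])
  assume f: "f \<in> ideal_power ?R ?I s"
  have "f \<in> local_contraction ?R P (ideal_power ?R ?I s)" if ass: "P \<in> associated_primes ?R ?I" for P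
  proof -
    have P: "primeideal P ?R" using ass by (simp add: associated_primes_def)
    then have "\<one>\<^bsub>?R\<^esub> \<notin> P"
      using ideal.one_imp_carrier primeideal.I_notcarr primeideal.axioms(1) by metis
    then have "\<exists>t \<in> carrier ?R - P. t \<otimes>\<^bsub>?R\<^esub> f \<in> ideal_power ?R ?I s"
      using f J.Icarr[OF f] by (intro bexI[of _ "\<one>\<^bsub>?R\<^esub>"]) auto
    then show ?thesis
      using J.Icarr[OF f] by (simp add: local_contraction_iff[OF P J.ideal_axioms])
  qed
  then show "f \<in> symbolic_power ?R ?I s"
    using J.Icarr[OF f] by (simp add: symbolic_power_def)
qed

text \<open>Together with \<open>symbolic_power_monomialwise\<close>, this reduces membership in a symbolic power to
  monomial multipliers that avoid the associated primes.\<close>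

lemma monomial_in_symbolic_power:
  assumes V: "finite V" and keys_G: "\<And>g. g \<in> G \<Longrightarrow> keys g \<subseteq> V" and u: "keys u \<subseteq> V"
    and local: "\<And>P. P \<in> associated_primes (poly_ring V) (monomial_ideal V G :: ('v, 'k::idom) mpoly set) \<Longrightarrow>
      \<exists>m. keys m \<subseteq> V \<and> (\<forall>v\<in>keys m. pvar v \<notin> P) \<and> u + m \<in> multiples (sums_of G s)"
  shows "Poly_Mapping.single u 1 \<in> symbolic_power (poly_ring V) (monomial_ideal V G :: ('v, 'k) mpoly set) s"
proof -
  let ?R = "poly_ring V :: ('v, 'k) mpoly ring" and ?I = "monomial_ideal V G :: ('v, 'k) mpoly set"
  let ?u = "Poly_Mapping.single u (1::'k)"
  have power: "ideal_power ?R ?I s = monomial_ideal V (sums_of G s)"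
    by (rule ideal_power_monomial_ideal) (rule keys_G)
  have ideal_power: "ideal (ideal_power ?R ?I s) ?R"
    by (rule ideal_ideal_power) (rule keys_G)
  have "?u \<in> local_contraction ?R P (ideal_power ?R ?I s)" if ass: "P \<in> associated_primes ?R ?I" for P
  proof -
    have P: "primeideal P ?R" using ass by (simp add: associated_primes_def)
    obtain m where m: "keys m \<subseteq> V" "\<forall>v\<in>keys m. pvar v \<notin> P" "u + m \<in> multiples (sums_of G s)"
      using local[OF ass] by blast
    then have "Poly_Mapping.single m 1 \<notin> P" using variable_in_prime[OF V P] by blast
    moreover have "Poly_Mapping.single m 1 * ?u \<in> ideal_power ?R ?I s"
      unfolding power using m u by (simp add: monomial_ideal_def mult_single add.commute keys_add_monomial)
    ultimately show ?thesis
      using u m by (subst local_contraction_iff[OF P ideal_power])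
        (auto intro!: bexI[of _ "Poly_Mapping.single m 1"])
  qed
  then show ?thesis using u by (simp add: symbolic_power_def)
qed

lemma symbolic_power_monomialwise:
  fixes F :: "('v, 'k::idom) mpoly"
  assumes V: "finite V" and keys_G: "\<And>g. g \<in> G \<Longrightarrow> keys g \<subseteq> V"
    and F: "F \<in> symbolic_power (poly_ring V) (monomial_ideal V G) s" "u \<in> keys F"
    and C: "(variable_prime V C :: ('v, 'k) mpoly set) \<in> associated_primes (poly_ring V) (monomial_ideal V G)"
  obtains m where "keys m \<subseteq> V - C" "u + m \<in> multiples (sums_of G s)"
proof -
  let ?R = "poly_ring V :: ('v, 'k) mpoly ring" and ?I = "monomial_ideal V G :: ('v, 'k) mpoly set"
  have power: "ideal_power ?R ?I s = monomial_ideal V (sums_of G s)"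
    by (rule ideal_power_monomial_ideal) (rule keys_G)
  have ideal_power: "ideal (ideal_power ?R ?I s) ?R"
    by (rule ideal_ideal_power) (rule keys_G)
  have "F \<in> local_contraction ?R (variable_prime V C) (ideal_power ?R ?I s)"
    using F C by (simp add: symbolic_power_def)
  then obtain t where "F \<in> carrier ?R" "t \<in> carrier ?R" "t \<notin> variable_prime V C"
    "t * F \<in> monomial_ideal V (sums_of G s)"
    unfolding local_contraction_iff[OF primeideal_variable_prime ideal_power]
    unfolding power poly_ring_simps(2) by blast
  then show thesis
    using contraction_monomialwise[OF V] F(2) that by blast
qed

section \<open>Edge monomials and induced subgraphs\<close>

definition edge_monomial :: "'v wo_graph \<Rightarrow> 'v \<times> 'v \<Rightarrow> ('v \<Rightarrow>\<^sub>0 nat)" where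
  "edge_monomial D e = Poly_Mapping.single (fst e) 1 + Poly_Mapping.single (snd e) (weight D (snd e))"

lemma lookup_edge_monomial:
  "lookup (edge_monomial D (x, y)) v = (if v = x then 1 else 0) + (if v = y then weight D y else 0)"
  by (simp add: edge_monomial_def lookup_add lookup_single when_def)

lemma pvar_power: "pvar y ^ n = Poly_Mapping.single (Poly_Mapping.single y n) (1 :: 'k::comm_ring_1)"
  by (induction n) (simp_all add: pvar_def mult_single flip: single_add)

lemma edge_ideal_eq:
  assumes "edges D \<subseteq> verts D \<times> verts D"
  shows "(edge_ideal D :: ('v, 'k::field) mpoly set) = monomial_ideal (verts D) (edge_monomial D ` edges D)"
proof -
  have "{pvar x * pvar y ^ weight D y | x y. (x, y) \<in> edges D} =
      {Poly_Mapping.single g (1 :: 'k) | g. g \<in> edge_monomial D ` edges D}"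
    unfolding pvar_power
    by (force simp: pvar_def edge_monomial_def mult_single)
  moreover have "keys g \<subseteq> verts D" if "g \<in> edge_monomial D ` edges D" for g
    using that assms by (auto simp: edge_monomial_def keys_add_monomial split: if_splits)
  ultimately show ?thesis unfolding edge_ideal_def by (simp add: genideal_monomials)
qed

context weighted_oriented_graph
begin

abbreviation edge_monomials :: "('v \<Rightarrow>\<^sub>0 nat) set" where
  "edge_monomials \<equiv> edge_monomial D ` edges D"

lemma keys_edge_monomial:
  assumes "(x, y) \<in> edges D"
  shows "keys (edge_monomial D (x, y)) = {x, y}"
proof -
  have "weight D y \<ge> 1" using assms edges_in_verts weight_pos by blast
  then show ?thesis by (auto simp: edge_monomial_def keys_add_monomial)
qed

lemma keys_edge_monomials: "g \<in> edge_monomials \<Longrightarrow> keys g \<subseteq> verts D"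
  using keys_edge_monomial edges_in_verts by fastforce

lemma edge_neq: "(x, y) \<in> edges D \<Longrightarrow> x \<noteq> y"
  using oriented by blast

lemma edge_monomial_le_weight:
  assumes "g \<in> edge_monomials" "v \<in> verts D"
  shows "lookup g v \<le> weight D v"
  using assms weight_pos edge_neq by (fastforce simp: lookup_edge_monomial)

text \<open>Passing to an induced subgraph changes only the weights of new sources, and the weight of a source
  occurs in no edge monomial.\<close>

lemma edge_monomials_induced:
  assumes "T \<subseteq> verts D"
  shows "edge_monomial (induced_wo_graph D T) ` edges (induced_wo_graph D T) =
    {g \<in> edge_monomials. keys g \<subseteq> T}"
proof -
  have eq: "edge_monomial (induced_wo_graph D T) (x, y) = edge_monomial D (x, y)"
    if "(x, y) \<in> edges D" "x \<in> T" "y \<in> T" for x y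
    using that by (auto simp: edge_monomial_def induced_wo_graph_def)
  have E: "edges (induced_wo_graph D T) = {(x, y) \<in> edges D. x \<in> T \<and> y \<in> T}"
    by (simp add: induced_wo_graph_def)
  show ?thesis
  proof safe
    fix x y assume "(x, y) \<in> edges (induced_wo_graph D T)"
    then have xy: "(x, y) \<in> edges D" "x \<in> T" "y \<in> T" by (auto simp: E)
    show "edge_monomial (induced_wo_graph D T) (x, y) \<in> edge_monomials"
      using xy eq by (metis imageI)
    fix v assume "v \<in> keys (edge_monomial (induced_wo_graph D T) (x, y))"
    then show "v \<in> T" using xy by (auto simp: eq keys_edge_monomial)
  next
    fix x y assume "(x, y) \<in> edges D" "keys (edge_monomial D (x, y)) \<subseteq> T"
    moreover from this have "x \<in> T" "y \<in> T" by (auto simp: keys_edge_monomial)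
    ultimately show "edge_monomial D (x, y) \<in> edge_monomial (induced_wo_graph D T) ` edges (induced_wo_graph D T)"
      by (intro image_eqI[of _ _ "(x, y)"]) (simp_all add: eq E)
  qed
qed

text \<open>No generator contains \<open>z\<close> to a higher power than the weight of \<open>z\<close>. If an edge with this
  exponent divides \<open>ga\<close>, then \<open>g\<close> already contains the full power of \<open>z\<close>, and multiplying
  \<open>g\<close> by \<open>z\<close> cannot help any generator to divide it.\<close>

lemma neighbour_not_in_cover:
  assumes g: "g \<notin> multiples edge_monomials"
    and e: "e \<in> edge_monomials" "\<And>v. lookup e v \<le> lookup (g + Poly_Mapping.single a 1) v"
    and z: "z \<in> verts D" "z \<noteq> a" "lookup e z = weight D z"
  shows "g + Poly_Mapping.single z 1 \<notin> multiples edge_monomials"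
proof
  assume "g + Poly_Mapping.single z 1 \<in> multiples edge_monomials"
  then obtain f where f: "f \<in> edge_monomials" "\<And>v. lookup f v \<le> lookup (g + Poly_Mapping.single z 1) v"
    by (auto simp: mem_multiples_iff)
  have "lookup f v \<le> lookup g v" for v
  proof (cases "v = z")
    case True
    have "lookup f z \<le> weight D z" using f z by (intro edge_monomial_le_weight)
    also have "\<dots> \<le> lookup g z"
      using e(2)[of z] z by (simp add: lookup_add lookup_single when_def)
    finally show ?thesis using True by simp
  next
    case False
    then show ?thesis using f(2)[of v] by (simp add: lookup_add lookup_single when_def)
  qed
  with f g show False by (auto simp: mem_multiples_iff)
qed

end

text \<open>Trading each factor for one free of \<open>b\<close>, at the cost of a power of \<open>z\<close>.\<close>

lemma sums_of_replace:
  assumes replace: "\<And>f. f \<in> H \<Longrightarrow> \<exists>f'\<in>H. lookup f' b = 0 \<and>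
      (\<forall>v. lookup f' v \<le> lookup (f + Poly_Mapping.single z K) v)"
    and t: "t \<in> sums_of H s"
  obtains t' where "t' \<in> sums_of H s" "lookup t' b = 0"
    "\<And>v. lookup t' v \<le> lookup (t + Poly_Mapping.single z (s * K)) v"
proof -
  have "\<exists>t'\<in>sums_of H s. lookup t' b = 0 \<and>
      (\<forall>v. lookup t' v \<le> lookup (t + Poly_Mapping.single z (s * K)) v)"
    using t
  proof (induction s arbitrary: t)
    case 0
    then show ?case by simp
  next
    case (Suc s)
    then obtain a f where t: "t = a + f" "a \<in> sums_of H s" "f \<in> H" by auto
    from Suc.IH[OF t(2)] obtain a' where a': "a' \<in> sums_of H s" "lookup a' b = 0"
      "\<And>v. lookup a' v \<le> lookup (a + Poly_Mapping.single z (s * K)) v" by blast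
    from replace[OF t(3)] obtain f' where f': "f' \<in> H" "lookup f' b = 0"
      "\<And>v. lookup f' v \<le> lookup (f + Poly_Mapping.single z K) v" by blast
    have "lookup (a' + f') v \<le> lookup (t + Poly_Mapping.single z (Suc s * K)) v" for v
      using add_mono[OF a'(3)[of v] f'(3)[of v]]
      by (cases "v = z") (simp_all add: t lookup_add lookup_single)
    then show ?case
      using a' f' by (intro bexI[of _ "a' + f'"]) (auto simp: lookup_add)
  qed
  with that show thesis by blast
qed

lemma sums_of_mono: "H \<subseteq> G \<Longrightarrow> sums_of H s \<subseteq> sums_of G s"
  by (induction s) auto

lemma sums_of_restrict:
  assumes "t \<in> sums_of G s" "keys t \<subseteq> T"
  shows "t \<in> sums_of {g \<in> G. keys g \<subseteq> T} s"
  using assms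
proof (induction s arbitrary: t)
  case (Suc s)
  then obtain a g where "t = a + g" "a \<in> sums_of G s" "g \<in> G" by auto
  with Suc show ?case by (auto simp: keys_add_monomial)
qed simp

definition restrict_monomial :: "'v set \<Rightarrow> ('v \<Rightarrow>\<^sub>0 nat) \<Rightarrow> ('v \<Rightarrow>\<^sub>0 nat)" where
  "restrict_monomial X = Poly_Mapping.mapp (\<lambda>v n. if v \<in> X then n else 0)"

lemma lookup_restrict_monomial: "lookup (restrict_monomial X m) v = (if v \<in> X then lookup m v else 0)"
  by (auto simp: restrict_monomial_def lookup_mapp when_def in_keys_iff)

lemma keys_restrict_monomial: "keys (restrict_monomial X m) = keys m \<inter> X"
  by (auto simp: in_keys_iff lookup_restrict_monomial split: if_splits)

section \<open>Attaching a graph at a leaf\<close>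

text \<open>The part of the path structure that the argument needs: inside \<open>X\<close> the vertex \<open>b\<close> has the single
  neighbour \<open>a\<close>, and every edge leaving \<open>X\<close> starts or ends at \<open>b\<close>.\<close>

locale induced_leaf = weighted_oriented_graph D for D :: "'v wo_graph" +
  fixes X :: "'v set" and a b :: 'v
  assumes X_verts: "X \<subseteq> verts D"
    and a_in_X: "a \<in> X" and b_in_X: "b \<in> X"
    and ab_adjacent: "(a, b) \<in> edges D \<or> (b, a) \<in> edges D"
    and leaf: "(x, y) \<in> edges D \<Longrightarrow> x \<in> X \<Longrightarrow> y \<in> X \<Longrightarrow> b \<in> {x, y} \<Longrightarrow> {x, y} = {a, b}"
    and boundary: "(x, y) \<in> edges D \<Longrightarrow> v \<in> {x, y} \<Longrightarrow> v \<in> X \<Longrightarrow> v \<noteq> b \<Longrightarrow> {x, y} \<subseteq> X"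
    and in_nbrs_a: "in_nbrs D a \<inter> vplus D = {}"
begin

abbreviation "inner_monomials \<equiv> {g \<in> edge_monomials. keys g \<subseteq> X}"

lemma a_neq_b: "a \<noteq> b"
  using ab_adjacent edge_neq by blast

lemma inner_monomialI:
  assumes "f \<in> edge_monomials" "v \<in> keys f" "v \<in> X" "v \<noteq> b"
  shows "f \<in> inner_monomials"
proof -
  obtain x y where "(x, y) \<in> edges D" "f = edge_monomial D (x, y)" using assms by auto
  with boundary[of x y v] assms show ?thesis by (auto simp: keys_edge_monomial)
qed

text \<open>Here \<open>C\<close> plays the role of the variables of an associated prime and \<open>g\<close> that of a witness for it. The
  assumption \<open>blocked\<close> says that no power of \<open>b\<close> makes \<open>g\<close> divisible by an inner edge; this concerns
  in particular the edge \<open>e\<^sub>0\<close> between \<open>a\<close> and \<open>b\<close>, which therefore fails at \<open>a\<close>: the exponent of \<open>a\<close>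
  in \<open>e\<^sub>0\<close> exceeds that in \<open>g\<close>. Hence \<open>a\<close> is in \<open>C\<close>, since otherwise \<open>g\<close> would
  contain the full power of \<open>a\<close>; so some edge \<open>e\<close> between \<open>a\<close> and a vertex \<open>z\<close>
  divides \<open>ga\<close>. Since heavy vertices do not point to \<open>a\<close>, the exponent of \<open>z\<close> in \<open>e\<close> is the weight of
  \<open>z\<close>, and \<open>neighbour_not_in_cover\<close> keeps \<open>z\<close> out of \<open>C\<close>; as \<open>b\<close> is in \<open>C\<close>, it is not \<open>z\<close>. Finally the
  exponent of \<open>a\<close> in \<open>e\<close> is at most one more than in \<open>g\<close>, so at most that in \<open>e\<^sub>0\<close>. Thus \<open>e\<close> divides
  \<open>e\<^sub>0\<close> times a power of \<open>z\<close>, and it can replace \<open>e\<^sub>0\<close>, the only inner edge at \<open>b\<close>.\<close>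

lemma leaf_edge_redirect:
  assumes C: "a \<notin> C \<Longrightarrow> weight D a \<le> lookup g a" "b \<in> C"
    and g: "g \<notin> multiples edge_monomials"
      "\<And>v. v \<in> verts D \<Longrightarrow> v \<in> C \<Longrightarrow> g + Poly_Mapping.single v 1 \<in> multiples edge_monomials"
    and blocked: "\<And>f. f \<in> inner_monomials \<Longrightarrow> \<exists>v. v \<noteq> b \<and> lookup g v < lookup f v"
  obtains z K where "z \<in> X" "z \<notin> C"
    "\<And>f. f \<in> inner_monomials \<Longrightarrow> \<exists>f'\<in>inner_monomials. lookup f' b = 0 \<and>
      (\<forall>v. lookup f' v \<le> lookup (f + Poly_Mapping.single z K) v)"
proof -
  have verts: "a \<in> verts D" "b \<in> verts D" using X_verts a_in_X b_in_X by auto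
  obtain x\<^sub>0 y\<^sub>0 where e0: "(x\<^sub>0, y\<^sub>0) \<in> edges D" "{x\<^sub>0, y\<^sub>0} = {a, b}"
    using ab_adjacent by blast
  define e\<^sub>0 where "e\<^sub>0 = edge_monomial D (x\<^sub>0, y\<^sub>0)"
  have keys_e0: "keys e\<^sub>0 = {a, b}" using e0 by (simp add: e\<^sub>0_def keys_edge_monomial)
  have e0_inner: "e\<^sub>0 \<in> inner_monomials"
    using e0 keys_e0 a_in_X b_in_X by (auto simp: e\<^sub>0_def)
  have e0_a: "lookup g a < lookup e\<^sub>0 a"
  proof -
    obtain v where "v \<noteq> b" "lookup g v < lookup e\<^sub>0 v" using blocked[OF e0_inner] by blast
    moreover from this have "v \<in> keys e\<^sub>0" by (auto simp: in_keys_iff)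
    ultimately show ?thesis using keys_e0 by auto
  qed
  have "a \<in> C"
  proof (rule ccontr)
    assume "a \<notin> C"
    then have "weight D a \<le> lookup g a" by (rule C)
    moreover have "lookup e\<^sub>0 a \<le> weight D a"
      using e0_inner verts by (intro edge_monomial_le_weight) auto
    ultimately show False using e0_a by simp
  qed
  then obtain e where e: "e \<in> edge_monomials" "\<And>v. lookup e v \<le> lookup (g + Poly_Mapping.single a 1) v"
    using g(2)[of a] verts by (auto simp: mem_multiples_iff)
  have e_a: "lookup g a < lookup e a"
  proof (rule ccontr)
    assume *: "\<not> ?thesis"
    have "lookup e v \<le> lookup g v" for v
      using e(2)[of v] * by (cases "v = a") (auto simp: lookup_add lookup_single when_def)
    with e g show False by (auto simp: mem_multiples_iff)
  qed
  then have a_key: "a \<in> keys e" by (auto simp: in_keys_iff)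
  have e_inner: "e \<in> inner_monomials"
    using inner_monomialI[OF e(1) a_key a_in_X a_neq_b] .
  obtain x y where xy: "(x, y) \<in> edges D" "e = edge_monomial D (x, y)" using e by auto
  define z where "z = (if x = a then y else x)"
  have xy_z: "{x, y} = {a, z}" using a_key xy by (auto simp: z_def keys_edge_monomial)
  have za: "z \<noteq> a" using xy edge_neq by (auto simp: z_def)
  have keys_e: "keys e = {a, z}" using xy xy_z by (simp add: keys_edge_monomial)
  then have "z \<in> X" using e_inner by auto
  then have "z \<in> verts D" using X_verts by blast
  have "lookup e z = weight D z"
  proof (cases "x = a")
    case True
    then show ?thesis using xy za by (simp add: lookup_edge_monomial z_def)
  next
    case False
    then have "x = z" "y = a" using xy_z za by (auto simp: doubleton_eq_iff)
    moreover from this have "weight D z = 1"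
      using in_nbrs_a xy \<open>z \<in> verts D\<close> by (auto simp: in_nbrs_def vplus_def)
    ultimately show ?thesis using xy za by (simp add: lookup_edge_monomial)
  qed
  then have "g + Poly_Mapping.single z 1 \<notin> multiples edge_monomials"
    using neighbour_not_in_cover[OF g(1) e \<open>z \<in> verts D\<close> za] by blast
  then have "z \<notin> C" using g(2) \<open>z \<in> verts D\<close> by blast
  with C have "z \<noteq> b" by blast
  have e_b: "lookup e b = 0"
    using keys_e a_neq_b \<open>z \<noteq> b\<close> by (metis in_keys_iff insertE singletonD)
  show thesis
  proof (rule that[of z "lookup e z", OF \<open>z \<in> X\<close> \<open>z \<notin> C\<close>])
    fix f assume f: "f \<in> inner_monomials"
    show "\<exists>f'\<in>inner_monomials. lookup f' b = 0 \<and>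
      (\<forall>v. lookup f' v \<le> lookup (f + Poly_Mapping.single z (lookup e z)) v)"
    proof (cases "b \<in> keys f")
      case False
      then show ?thesis using f by (intro bexI[of _ f]) (auto simp: lookup_add in_keys_iff)
    next
      case True
      obtain p q where pq: "(p, q) \<in> edges D" "f = edge_monomial D (p, q)" using f by auto
      then have "{p, q} = {a, b}"
        using True f leaf[OF pq(1)] by (auto simp: keys_edge_monomial)
      then have "(p, q) = (x\<^sub>0, y\<^sub>0)"
        using e0 pq oriented by (auto simp: doubleton_eq_iff)
      then have "f = e\<^sub>0" using pq by (simp add: e\<^sub>0_def)
      have "lookup e a \<le> Suc (lookup g a)"
        using e(2)[of a] by (simp add: lookup_add)
      then have "lookup e a \<le> lookup f a" using e0_a \<open>f = e\<^sub>0\<close> by simp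
      moreover have "lookup e v = 0" if "v \<noteq> a" "v \<noteq> z" for v
        using that keys_e by (metis in_keys_iff insertE singletonD)
      ultimately have "lookup e v \<le> lookup (f + Poly_Mapping.single z (lookup e z)) v" for v
        by (cases "v = a"; cases "v = z") (simp_all add: lookup_add)
      then show ?thesis using e_inner e_b by blast
    qed
  qed
qed

text \<open>The witness \<open>g\<close> for \<open>P\<close> restricts to a monomial \<open>h\<close> on \<open>X\<close> outside the smaller ideal, and \<open>h\<close> leads to
  an associated prime of that ideal with variables \<open>C'\<close>. A variable of \<open>P\<close> in \<open>X\<close> other than \<open>b\<close> has
  all its edges inside \<open>X\<close> and therefore lies in \<open>C'\<close>. So a multiplier avoiding \<open>C'\<close> avoids \<open>P\<close>,
  except perhaps for powers of \<open>b\<close>, which \<open>leaf_edge_redirect\<close> makes superfluous.\<close>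

lemma local_multiplier:
  fixes P :: "('v, 'k::field) mpoly set"
  assumes P: "P \<in> associated_primes (poly_ring (verts D)) (monomial_ideal (verts D) edge_monomials)"
    and u: "keys u \<subseteq> X"
    and inner: "\<And>C. (variable_prime X C :: ('v, 'k) mpoly set) \<in>
        associated_primes (poly_ring X) (monomial_ideal X inner_monomials) \<Longrightarrow>
      \<exists>m. keys m \<subseteq> X - C \<and> u + m \<in> multiples (sums_of inner_monomials s)"
  shows "\<exists>m. keys m \<subseteq> verts D \<and> (\<forall>v\<in>keys m. pvar v \<notin> P) \<and> u + m \<in> multiples (sums_of edge_monomials s)"
proof -
  define C where "C = {v. pvar v \<in> P}"
  \<comment> \<open>forces \<open>g\<close> to contain the full power of \<open>a\<close> when \<open>a\<close> is a unit at \<open>P\<close>; then the edge between \<open>a\<close> and \<open>b\<close> is never blocked\<close>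
  define q where "q = (if a \<in> C then 0 else Poly_Mapping.single a (weight D a))"
  have a_verts: "a \<in> verts D" using X_verts a_in_X by blast
  obtain g where g: "keys g \<subseteq> verts D" "g \<notin> multiples edge_monomials" "\<And>v. lookup q v \<le> lookup g v"
    "\<And>v. v \<in> verts D \<Longrightarrow> pvar v \<in> P \<Longrightarrow> g + Poly_Mapping.single v 1 \<in> multiples edge_monomials"
    by (rule associated_prime_witness[OF finite_verts P, of q])
      (use a_verts in \<open>auto simp: q_def C_def split: if_splits\<close>)
  have g_a: "weight D a \<le> lookup g a" if "a \<notin> C"
    using g(3)[of a] that by (simp add: q_def)
  define h where "h = restrict_monomial X g"
  have keys_h: "keys h \<subseteq> X" by (simp add: h_def keys_restrict_monomial)
  have "h \<notin> multiples inner_monomials"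
  proof
    assume "h \<in> multiples inner_monomials"
    then obtain f where "f \<in> edge_monomials" "\<And>v. lookup f v \<le> lookup h v"
      by (auto simp: mem_multiples_iff)
    moreover have "lookup h v \<le> lookup g v" for v by (simp add: h_def lookup_restrict_monomial)
    ultimately show False using g(2) by (meson le_trans mem_multiples_iff)
  qed
  moreover have "finite X" using X_verts finite_verts finite_subset by blast
  moreover have "lookup f v \<le> weight D v + 1" if f: "f \<in> inner_monomials" for f v
    using f by (auto simp: lookup_edge_monomial)
  ultimately obtain C' where
    C': "(variable_prime X C' :: ('v, 'k) mpoly set) \<in> associated_primes (poly_ring X) (monomial_ideal X inner_monomials)"
    and C'_vars: "\<And>v N. v \<in> X \<Longrightarrow> h + Poly_Mapping.single v N \<in> multiples inner_monomials \<Longrightarrow> v \<in> C'"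
    using exists_associated_prime[of X inner_monomials "\<lambda>v. weight D v + 1" h] keys_h by blast
  have C'_off_leaf: "v \<in> C'" if v: "v \<in> C" "v \<in> X" "v \<noteq> b" for v
  proof (rule C'_vars[OF v(2), of 1])
    obtain f where f: "f \<in> edge_monomials" "\<And>x. lookup f x \<le> lookup (g + Poly_Mapping.single v 1) x"
      using g(4)[of v] v X_verts by (auto simp: mem_multiples_iff C_def)
    have "v \<in> keys f"
    proof (rule ccontr)
      assume "v \<notin> keys f"
      then have "lookup f x \<le> lookup g x" for x
        using f(2)[of x] by (cases "x = v") (auto simp: lookup_add lookup_single when_def in_keys_iff)
      with f g(2) show False by (auto simp: mem_multiples_iff)
    qed
    then have "f \<in> inner_monomials" by (rule inner_monomialI[OF f(1) _ v(2,3)])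
    moreover have "lookup f x \<le> lookup (h + Poly_Mapping.single v 1) x" for x
    proof (cases "x \<in> X")
      case True
      then show ?thesis using f(2)[of x] by (simp add: lookup_add h_def lookup_restrict_monomial)
    next
      case False
      then have "x \<notin> keys f" using \<open>f \<in> inner_monomials\<close> by blast
      then show ?thesis by (simp add: in_keys_iff)
    qed
    ultimately show "h + Poly_Mapping.single v 1 \<in> multiples inner_monomials"
      unfolding mem_multiples_iff by blast
  qed
  obtain m where m: "keys m \<subseteq> X - C'" "u + m \<in> multiples (sums_of inner_monomials s)"
    using inner[OF C'] by blast
  have sums: "multiples (sums_of inner_monomials s) \<subseteq> multiples (sums_of edge_monomials s)"
    using sums_of_mono[of inner_monomials edge_monomials s] unfolding multiples_def by blast
  show ?thesis
  proof (cases "b \<in> C \<and> b \<notin> C'")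
    case False
    then have "keys m \<inter> C = {}" using m(1) C'_off_leaf by blast
    then have "keys m \<subseteq> verts D \<and> (\<forall>v\<in>keys m. pvar v \<notin> P)"
      using m(1) X_verts unfolding C_def by blast
    then show ?thesis using m(2) sums by blast
  next
    case True
    have blocked: "\<exists>v. v \<noteq> b \<and> lookup g v < lookup f v" if f: "f \<in> inner_monomials" for f
    proof (rule ccontr)
      assume "\<not> ?thesis"
      then have *: "lookup f v \<le> lookup g v" if "v \<noteq> b" for v using that by (meson leI)
      have "lookup f v \<le> lookup (h + Poly_Mapping.single b (lookup f b)) v" for v
        using f *[of v]
        by (cases "v \<in> X"; cases "v = b")
          (auto simp: lookup_add lookup_single when_def h_def lookup_restrict_monomial in_keys_iff)
      then have "h + Poly_Mapping.single b (lookup f b) \<in> multiples inner_monomials"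
        unfolding mem_multiples_iff using f by blast
      then have "b \<in> C'" by (rule C'_vars[OF b_in_X])
      with True show False by blast
    qed
    obtain z K where z: "z \<in> X" "z \<notin> C"
      and replace: "\<And>f. f \<in> inner_monomials \<Longrightarrow> \<exists>f'\<in>inner_monomials. lookup f' b = 0 \<and>
        (\<forall>v. lookup f' v \<le> lookup (f + Poly_Mapping.single z K) v)"
    proof (rule leaf_edge_redirect[of C g])
      show "b \<in> C" using True by blast
      show "g + Poly_Mapping.single v 1 \<in> multiples edge_monomials" if "v \<in> verts D" "v \<in> C" for v
        using g(4)[of v] that by (simp add: C_def)
    qed (use g_a g(2) blocked in blast)+
    obtain t where t: "t \<in> sums_of inner_monomials s" "\<And>v. lookup t v \<le> lookup (u + m) v"
      using m(2) by (auto simp: mem_multiples_iff)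
    obtain t' where t': "t' \<in> sums_of inner_monomials s" "lookup t' b = 0"
      "\<And>v. lookup t' v \<le> lookup (t + Poly_Mapping.single z (s * K)) v"
      using sums_of_replace[OF replace t(1)] by blast
    \<comment> \<open>the divisor \<open>t'\<close> is free of \<open>b\<close>, so the powers of \<open>b\<close> in \<open>m\<close> can be dropped; those in \<open>u\<close> do no harm\<close>
    define m' where "m' = restrict_monomial (- {b}) m + Poly_Mapping.single z (s * K)"
    have "lookup t' v \<le> lookup (u + m') v" for v
      using t'(2) t'(3)[of v] t(2)[of v]
      by (cases "v = b") (auto simp: m'_def lookup_add lookup_restrict_monomial)
    then have "u + m' \<in> multiples (sums_of edge_monomials s)"
      using t'(1) sums unfolding mem_multiples_iff subset_iff by blast
    moreover have "keys m' \<subseteq> X - C"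
      using m(1) C'_off_leaf z
      by (auto simp: m'_def keys_add_monomial keys_restrict_monomial split: if_splits)
    ultimately show ?thesis
      using X_verts unfolding C_def by blast
  qed
qed

text \<open>A monomial of an element that separates the two powers of the smaller ideal separates the powers of
  the larger one: a product of edges that divides a monomial on \<open>X\<close> uses only inner edges.\<close>

theorem symbolic_power_neq_of_induced:
  assumes neq: "symbolic_power (poly_ring X) (monomial_ideal X inner_monomials :: ('v, 'k::field) mpoly set) s
    \<noteq> ideal_power (poly_ring X) (monomial_ideal X inner_monomials) s"
  shows "symbolic_power (poly_ring (verts D)) (monomial_ideal (verts D) edge_monomials :: ('v, 'k) mpoly set) s
    \<noteq> ideal_power (poly_ring (verts D)) (monomial_ideal (verts D) edge_monomials) s"
proof -
  let ?I' = "monomial_ideal X inner_monomials :: ('v, 'k) mpoly set"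
  let ?I = "monomial_ideal (verts D) edge_monomials :: ('v, 'k) mpoly set"
  have inner_keys: "keys g \<subseteq> X" if "g \<in> inner_monomials" for g
    using that by blast
  have power': "ideal_power (poly_ring X) ?I' s = monomial_ideal X (sums_of inner_monomials s)"
    by (rule ideal_power_monomial_ideal) blast
  have power: "ideal_power (poly_ring (verts D)) ?I s = monomial_ideal (verts D) (sums_of edge_monomials s)"
    by (rule ideal_power_monomial_ideal) (rule keys_edge_monomials)
  have "ideal_power (poly_ring X) ?I' s \<subseteq> symbolic_power (poly_ring X) ?I' s"
    by (rule ideal_power_subset_symbolic_power) blast
  with neq obtain F where F: "F \<in> symbolic_power (poly_ring X) ?I' s"
    "F \<notin> monomial_ideal X (sums_of inner_monomials s)"
    unfolding power' by blast
  then have F_car: "F \<in> carrier (poly_ring X)" unfolding symbolic_power_def by blast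
  then obtain u where u: "u \<in> keys F" "u \<notin> multiples (sums_of inner_monomials s)"
    using F(2) unfolding monomial_ideal_iff by blast
  have keys_u: "keys u \<subseteq> X" using F_car u by simp
  have "Poly_Mapping.single u 1 \<in> symbolic_power (poly_ring (verts D)) ?I s"
  proof (rule monomial_in_symbolic_power[OF finite_verts])
    fix P :: "('v, 'k) mpoly set"
    assume P: "P \<in> associated_primes (poly_ring (verts D)) ?I"
    show "\<exists>m. keys m \<subseteq> verts D \<and> (\<forall>v\<in>keys m. pvar v \<notin> P) \<and> u + m \<in> multiples (sums_of edge_monomials s)"
    proof (rule local_multiplier[OF P keys_u])
      fix C assume "(variable_prime X C :: ('v, 'k) mpoly set) \<in> associated_primes (poly_ring X) ?I'"
      then obtain m where "keys m \<subseteq> X - C" "u + m \<in> multiples (sums_of inner_monomials s)"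
        using symbolic_power_monomialwise[OF finite_subset[OF X_verts finite_verts] inner_keys F(1) u(1), of C]
        by blast
      then show "\<exists>m. keys m \<subseteq> X - C \<and> u + m \<in> multiples (sums_of inner_monomials s)" by blast
    qed
  qed (use keys_edge_monomials keys_u X_verts in blast)+
  moreover have "Poly_Mapping.single u (1::'k) \<notin> monomial_ideal (verts D) (sums_of edge_monomials s)"
  proof
    assume "Poly_Mapping.single u (1::'k) \<in> monomial_ideal (verts D) (sums_of edge_monomials s)"
    then obtain t d where t: "t \<in> sums_of edge_monomials s" "u = t + d"
      by (auto simp: monomial_ideal_iff multiples_def)
    then have "keys t \<subseteq> X" using keys_u by (simp add: keys_add_monomial)
    then have "t \<in> sums_of inner_monomials s" by (rule sums_of_restrict[OF t(1)])
    with u t show False unfolding multiples_def by blast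
  qed
  ultimately show ?thesis unfolding power by metis
qed

end

section \<open>Initial segments of paths\<close>

context weighted_oriented_path
begin

lemma edge_consecutive:
  assumes "(u, v) \<in> edges D"
  obtains i where "Suc i < length vs" "{u, v} = {vs ! i, vs ! Suc i}"
  using assms adjacent_iff by blast

end

lemma induced_leaf_prefix:
  assumes path: "weighted_oriented_path D (xs @ ys)" and len: "length xs \<ge> 2"
    and nbrs: "in_nbrs D (xs ! (length xs - 2)) \<inter> vplus D = {}"
  shows "induced_leaf D (set xs) (xs ! (length xs - 2)) (xs ! (length xs - 1))"
proof -
  interpret weighted_oriented_path D "xs @ ys" by fact
  let ?vs = "xs @ ys" and ?n = "length xs"
  have in_xs: "?vs ! i \<in> set xs \<longleftrightarrow> i < ?n" if i: "i < length ?vs" for i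
  proof
    assume "?vs ! i \<in> set xs"
    then obtain j where j: "j < ?n" "xs ! j = ?vs ! i"
      unfolding in_set_conv_nth by blast
    then have "?vs ! j = ?vs ! i" by (metis nth_append_left)
    moreover have "j < length ?vs" using j(1) by simp
    ultimately have "j = i"
      using nth_eq_iff_index_eq[OF distinct_vs _ i] by blast
    with j(1) show "i < ?n" by simp
  next
    assume "i < ?n"
    then show "?vs ! i \<in> set xs" by (metis nth_append_left nth_mem)
  qed
  have a: "xs ! (?n - 2) = ?vs ! (?n - 2)" and b: "xs ! (?n - 1) = ?vs ! (?n - 1)"
    using len by (auto simp: nth_append)
  have is_b: "i = ?n - 1" if "i < length ?vs" "?vs ! i = xs ! (?n - 1)" for i
    using that nth_eq_iff_index_eq[OF distinct_vs, of i "?n - 1"] len b by simp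
  show ?thesis
  proof
    show "set xs \<subseteq> verts D" using set_vs by auto
    show "xs ! (?n - 2) \<in> set xs" "xs ! (?n - 1) \<in> set xs" using len by auto
    have "Suc (?n - 2) = ?n - 1" using len by simp
    then show "(xs ! (?n - 2), xs ! (?n - 1)) \<in> edges D \<or> (xs ! (?n - 1), xs ! (?n - 2)) \<in> edges D"
      unfolding adjacent_iff a b using len by (intro exI[of _ "?n - 2"]) simp
    show "in_nbrs D (xs ! (?n - 2)) \<inter> vplus D = {}" by (rule nbrs)
  next
    fix x y assume xy: "(x, y) \<in> edges D" "x \<in> set xs" "y \<in> set xs" "xs ! (?n - 1) \<in> {x, y}"
    obtain i where i: "Suc i < length ?vs" "{x, y} = {?vs ! i, ?vs ! Suc i}"
      using edge_consecutive[OF xy(1)] .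
    then have "Suc i < ?n" using xy in_xs[of "Suc i"] by auto
    moreover have "i = ?n - 1 \<or> Suc i = ?n - 1"
      using i xy(4) is_b[of i] is_b[of "Suc i"] by auto
    ultimately have "i = ?n - 2" "Suc i = ?n - 1" by auto
    then show "{x, y} = {xs ! (?n - 2), xs ! (?n - 1)}" unfolding a b i(2) by simp
  next
    fix x y v assume xy: "(x, y) \<in> edges D" "v \<in> {x, y}" "v \<in> set xs" "v \<noteq> xs ! (?n - 1)"
    obtain i where i: "Suc i < length ?vs" "{x, y} = {?vs ! i, ?vs ! Suc i}"
      using edge_consecutive[OF xy(1)] .
    have "i < ?n" using xy i in_xs[of i] in_xs[of "Suc i"] by auto
    moreover have "i \<noteq> ?n - 1"
    proof
      assume i': "i = ?n - 1"
      then have "Suc i = ?n" using len by simp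
      then have "v = ?vs ! ?n" using xy(2,4) i(2) i' b by auto
      with xy(3) in_xs[of ?n] i(1) \<open>Suc i = ?n\<close> show False by simp
    qed
    ultimately have "Suc i < ?n" by simp
    then show "{x, y} \<subseteq> set xs" unfolding i(2) using in_xs[of i] in_xs[of "Suc i"] i(1) by auto
  qed
qed

theorem theorem4p5:
  fixes D D' :: "'v wo_graph" and xs ys :: "'v list" and s :: nat
  assumes "weighted_oriented_path D (xs @ ys)"
    and "length xs \<ge> 2"
    and "D' = induced_wo_graph D (set xs)"
    and "in_nbrs D (xs ! (length xs - 2)) \<inter> vplus D = {}"
    and "s \<ge> 2"
    and "symbolic_power (graph_ring D') (edge_ideal D' :: ('v, 'k::field) mpoly set) s
           \<noteq> ideal_power (graph_ring D') (edge_ideal D') s"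
  shows "symbolic_power (graph_ring D) (edge_ideal D :: ('v, 'k) mpoly set) s
           \<noteq> ideal_power (graph_ring D) (edge_ideal D) s"
proof -
  interpret induced_leaf D "set xs" "xs ! (length xs - 2)" "xs ! (length xs - 1)"
    by (rule induced_leaf_prefix[OF assms(1,2,4)])
  have verts: "verts D' = set xs" and edges: "edges D' \<subseteq> verts D' \<times> verts D'"
    by (auto simp: assms(3) induced_wo_graph_def)
  have "edge_monomial D' ` edges D' = inner_monomials"
    unfolding assms(3) by (rule edge_monomials_induced[OF X_verts])
  then have "(edge_ideal D' :: ('v, 'k) mpoly set) = monomial_ideal (set xs) inner_monomials"
    unfolding edge_ideal_eq[OF edges] by (simp only: verts)
  with assms(6) have "symbolic_power (poly_ring (set xs)) (monomial_ideal (set xs) inner_monomials :: ('v, 'k) mpoly set) s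
      \<noteq> ideal_power (poly_ring (set xs)) (monomial_ideal (set xs) inner_monomials) s"
    unfolding verts by metis
  then show ?thesis
    unfolding edge_ideal_eq[OF edges_in_verts] by (rule symbolic_power_neq_of_induced)
qed

end
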